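(* Let $n\ge1$ be an integer and $t\in(0,\infty)$. Let $X$ be a random vector in $\mathbb{R}^n$ with $\frac1n\mathbb{E}[\|X\|^2]=\gamma\in(0,\infty)$, let $\Theta$ be a $1\times n$ random matrix (so $k=1$) whose entries are i.i.d. Gaussian with mean zero and variance $1/n$, and let $N\sim\mathcal{N}(0,1)$, with $X,\Theta,N$ independent. Let $Y=\Theta X+\sqrt t\,N$, let $P_{Y\mid\Theta}$ be the conditional distribution of $Y$ given $\Theta$, and let $G_Y=\mathcal{N}(0,\gamma+t)$. Then $$\mathbb{E}\left[D(P_{Y\mid\Theta}\,\|\,G_Y)\right]\le\frac{\alpha(X)}{2t}+\sqrt{\frac{\beta_1(X)}{t}},$$ where the expectation is with respect to $\Theta$.
   Context: $\|\cdot\|$ is the Euclidean norm and $\langle\cdot,\cdot\rangle$ the Euclidean inner product; logarithms are natural. For a random vector $X$ in $\mathbb{R}^n$ with $\mathbb{E}\|X\|^2<\infty$, define $$\alpha(X)=\frac1n\mathbb{E}\left[\left|\|X\|^2-\mathbb{E}[\|X\|^2]\right|\right],\qquad \beta_1(X)=\frac1n\mathbb{E}\left[|\langle X_1,X_2\rangle|\right],$$ where $X_1,X_2$ are independent copies of $X$. $D(P\|Q)=\int\log\left(\frac{dP}{dQ}\right)dP$ is the relative entropy. *)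

theory Defs
  imports "HOL-Probability.Probability"
begin

definition alpha :: "'a measure \<Rightarrow> ('a \<Rightarrow> real ^ 'n) \<Rightarrow> real" where
  "alpha M X = 1 / real CARD('n) *
     (\<integral>\<omega>. \<bar>(norm (X \<omega>))\<^sup>2 - (\<integral>\<omega>'. (norm (X \<omega>'))\<^sup>2 \<partial>M)\<bar> \<partial>M)"

(* Two independent copies of X are the coordinates of the square of the law of X. *)
definition beta1 :: "'a measure \<Rightarrow> ('a \<Rightarrow> real ^ 'n) \<Rightarrow> real" where
  "beta1 M X = 1 / real CARD('n) *
     (\<integral>z. \<bar>fst z \<bullet> snd z\<bar> \<partial>(distr M borel X \<Otimes>\<^sub>M distr M borel X))"

(* The second argument is the variance; normal_density expects the standard deviation. *)
definition gaussian :: "real \<Rightarrow> real \<Rightarrow> real measure" where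
  "gaussian m v = density lborel (normal_density m (sqrt v))"

(* D(P||Q). The library's KL_divergence takes the reference measure Q first, is real-valued,
   and carries no information if P is not absolutely continuous with respect to Q or if
   log(dP/dQ) is not P-integrable. For probability measures the negative part of log(dP/dQ)
   is always P-integrable, so the integral is infinite in the latter case. *)
definition relative_entropy :: "'b measure \<Rightarrow> 'b measure \<Rightarrow> ennreal" where
  "relative_entropy P Q =
     (if absolutely_continuous Q P \<and> integrable P (entropy_density (exp 1) Q P)
      then ennreal (KL_divergence (exp 1) Q P) else \<infinity>)"

(* Mutual independence of three Borel random variables of possibly different types;
   indep_vars needs a common value type. *)
definition indep_vars3 ::
  "'a measure \<Rightarrow> ('a \<Rightarrow> 'b::topological_space) \<Rightarrow> ('a \<Rightarrow> 'c::topological_space) \<Rightarrow>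
    ('a \<Rightarrow> 'd::topological_space) \<Rightarrow> bool" where
  "indep_vars3 M X Y Z \<longleftrightarrow>
     X \<in> borel_measurable M \<and> Y \<in> borel_measurable M \<and> Z \<in> borel_measurable M \<and>
     prob_space.indep_sets M
       (\<lambda>i::nat. if i = 0 then {X -` A \<inter> space M | A. A \<in> sets borel}
                 else if i = 1 then {Y -` A \<inter> space M | A. A \<in> sets borel}
                 else {Z -` A \<inter> space M | A. A \<in> sets borel}) {0, 1, 2}"

(* K is a regular conditional distribution of Y given Z, as a function of the value of Z;
   it is determined only up to null sets of the law of Z. *)
definition cond_distribution ::
  "'a measure \<Rightarrow> ('a \<Rightarrow> 'b::topological_space) \<Rightarrow> ('a \<Rightarrow> 'c::topological_space) \<Rightarrow>
    ('c \<Rightarrow> 'b measure) \<Rightarrow> bool" where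
  "cond_distribution M Y Z K \<longleftrightarrow>
     K \<in> borel \<rightarrow>\<^sub>M prob_algebra borel \<and>
     (\<forall>A\<in>sets borel. \<forall>B\<in>sets borel.
        emeasure M (Z -` A \<inter> Y -` B \<inter> space M) =
        (\<integral>\<^sup>+z. emeasure (K z) B * indicator A z \<partial>distr M borel Z))"

end

theory Submission
  imports Defs
begin

text \<open>Write \<open>S = t + \<parallel>X\<parallel>\<^sup>2 / n\<close>, let \<open>p\<^sub>\<theta>\<close> be the density of \<open>Y\<close> given \<open>\<Theta> = \<theta>\<close>, \<open>g\<close> the
density of \<open>N(0, \<gamma> + t)\<close>, and \<open>m(y)\<close>, \<open>V(y)\<close> the mean and the variance of \<open>p\<^sub>\<Theta>(y)\<close>. Bounding
\<open>ln\<close> from above by its tangent at \<open>E[p\<^sub>\<Theta>(y)\<^sup>2] / m(y)\<close> gives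
\<open>E[p\<^sub>\<Theta> ln (p\<^sub>\<Theta> / g)] \<le> m ln (m / g) + m ln (1 + V / m\<^sup>2)\<close>. Since \<open>m\<close> is the mixture of the densities of
\<open>N(0, S)\<close>, convexity bounds the first summand by the mean divergence of \<open>N(0, S)\<close> from \<open>N(0, \<gamma> + t)\<close>,
which is at most \<open>E\<bar>S - \<gamma> - t\<bar> / (2 t)\<close>. By \<open>ln (1 + x\<^sup>2) \<le> 0.89 x\<close> the second one is at most
\<open>0.89 \<surd>V\<close>, and Cauchy--Schwarz with the weight \<open>1 + y\<^sup>2 / (2 t)\<close> bounds its integral by a
weighted integral of \<open>V\<close>. The latter is explicit: \<open>V(y)\<close> is the mean over two copies \<open>X\<^sub>1, X\<^sub>2\<close> of the
difference at \<open>(y, y)\<close> of the centered bivariate normal densities with variances \<open>S\<^sub>1, S\<^sub>2\<close> and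
covariance \<open>\<langle>X\<^sub>1, X\<^sub>2\<rangle> / n\<close> or \<open>0\<close>. The constants combine to \<open>0.89\<^sup>2 \<surd>(\<pi> / 2) \<le> 1\<close>.\<close>

text \<open>After exponentiation the claim follows from the cubic Taylor polynomial of
  \<open>exp\<close> at \<open>89 / 100 * x\<close>. The constant is large enough to make the
  discriminant of a quadratic factor nonpositive, and it stays below the fourth root of 2 / pi,
  about 0.893, as the final combination of constants requires.\<close>

lemma ln_one_plus_square_le:
  fixes x :: real
  assumes "0 \<le> x"
  shows "ln (1 + x\<^sup>2) \<le> 89 / 100 * x"
proof -
  define z where "z = 89 / 100 * x"
  have z: "0 \<le> z" using assms by (simp add: z_def)
  have "(\<Sum>k<4. z ^ k /\<^sub>R fact k) \<le> exp z"
    unfolding exp_def using z by (intro sum_le_suminf summable_exp_generic) auto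
  then have taylor: "1 + z + z\<^sup>2 / 2 + z ^ 3 / 6 \<le> exp z"
    by (simp add: numeral_eq_Suc lessThan_Suc field_simps)
  define \<kappa> m k :: real where "\<kappa> = 89 / 100" and "m = 1 - \<kappa>\<^sup>2 / 2" and "k = \<kappa> ^ 3 / 6"
  have pos: "0 \<le> 4 * k * \<kappa> - m\<^sup>2" "0 < 4 * k"
    by (simp_all add: \<kappa>_def m_def k_def power2_eq_square power3_eq_cube)
  \<comment> \<open>This is \<open>4 * k\<close> times the difference of the Taylor polynomial and
    \<open>1 + x\<^sup>2\<close>, with the square completed in the quadratic that remains after
    \<open>x\<close> is factored out.\<close>
  have "0 \<le> x * ((2 * k * x - m)\<^sup>2 + (4 * k * \<kappa> - m\<^sup>2))"
    using assms pos by simp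
  also have "\<dots> = 4 * k * (\<kappa> * x - m * x\<^sup>2 + k * x ^ 3)"
    by (simp add: algebra_simps power2_eq_square power3_eq_cube)
  finally have "0 \<le> \<kappa> * x - m * x\<^sup>2 + k * x ^ 3"
    using pos by (simp add: zero_le_mult_iff)
  then have "1 + x\<^sup>2 \<le> 1 + z + z\<^sup>2 / 2 + z ^ 3 / 6"
    by (simp add: z_def m_def k_def \<kappa>_def power2_eq_square power3_eq_cube algebra_simps)
  with taylor have "1 + x\<^sup>2 \<le> exp z" by linarith
  then have "ln (1 + x\<^sup>2) \<le> ln (exp z)"
    by (subst ln_le_cancel_iff) (auto intro: add_pos_nonneg)
  then show ?thesis by (simp add: z_def)
qed

subsection \<open>Gaussian integrals\<close>

text \<open>Completing the square turns the integrand into a multiple of the normal density with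
  mean \<open>B / A\<close> and variance \<open>1 / A\<close>.\<close>

lemma nn_integral_exp_quadratic:
  fixes A B C :: real
  assumes "0 < A"
  shows "(\<integral>\<^sup>+x. ennreal (exp (- (A * x\<^sup>2 - 2 * B * x + C) / 2)) \<partial>lborel)
    = ennreal (sqrt (2 * pi / A) * exp (- (C - B\<^sup>2 / A) / 2))"
proof -
  have eq: "exp (- (A * x\<^sup>2 - 2 * B * x + C) / 2)
      = sqrt (2 * pi / A) * exp (- (C - B\<^sup>2 / A) / 2) * normal_density (B / A) (sqrt (1 / A)) x" for x
  proof -
    have "- (A * x\<^sup>2 - 2 * B * x + C) / 2 = - (C - B\<^sup>2 / A) / 2 + - (x - B / A)\<^sup>2 / (2 * (1 / A))"
      using assms by (simp add: field_simps power2_eq_square)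
    moreover have "sqrt (2 * pi / A) * (1 / sqrt (2 * pi * (1 / A))) = 1"
      using assms by simp
    ultimately show ?thesis
      using assms by (simp only: exp_add mult.assoc) (simp add: normal_density_def)
  qed
  have "(\<integral>\<^sup>+x. ennreal (normal_density (B / A) (sqrt (1 / A)) x) \<partial>lborel) = 1"
    using assms by (subst nn_integral_eq_integral) auto
  then show ?thesis
    using assms unfolding eq
    by (subst ennreal_mult) (auto simp: nn_integral_cmult)
qed

text \<open>The centered bivariate normal density with variances \<open>a\<close>, \<open>b\<close>
  and covariance \<open>c\<close>, the inverse covariance matrix being written out. It has this
  meaning only if \<open>a\<close> and \<open>b\<close> are positive and
  \<open>c\<^sup>2 < a * b\<close>, so this condition is tracked below.\<close>

definition binormal_density :: "real \<Rightarrow> real \<Rightarrow> real \<Rightarrow> real \<Rightarrow> real \<Rightarrow> real" where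
  "binormal_density a b c u v =
     exp (- ((b * u\<^sup>2 - 2 * c * u * v + a * v\<^sup>2) / (a * b - c\<^sup>2)) / 2) / (2 * pi * sqrt (a * b - c\<^sup>2))"

lemma binormal_density_measurable [measurable (raw)]:
  assumes [measurable]: "a \<in> borel_measurable M" "b \<in> borel_measurable M" "c \<in> borel_measurable M"
    "u \<in> borel_measurable M" "v \<in> borel_measurable M"
  shows "(\<lambda>x. binormal_density (a x) (b x) (c x) (u x) (v x)) \<in> borel_measurable M"
  unfolding binormal_density_def by measurable

lemma binormal_density_independent:
  assumes "0 < a" "0 < b"
  shows "binormal_density a b 0 u v = normal_density 0 (sqrt a) u * normal_density 0 (sqrt b) v"
proof -
  have "- ((b * u\<^sup>2 + a * v\<^sup>2) / (a * b)) / 2 = - u\<^sup>2 / (2 * a) + - v\<^sup>2 / (2 * b)"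
    using assms by (simp add: field_simps)
  moreover have "sqrt (2 * pi * a) * sqrt (2 * pi * b) = sqrt ((2 * pi)\<^sup>2 * (a * b))"
    by (simp add: real_sqrt_mult [symmetric] power2_eq_square mult_ac)
  then have "sqrt (2 * pi * a) * sqrt (2 * pi * b) = 2 * pi * sqrt (a * b)"
    by (simp only: real_sqrt_mult [of "(2 * pi)\<^sup>2"] real_sqrt_abs) simp
  ultimately show ?thesis
    using assms by (simp add: binormal_density_def normal_density_def mult_exp_exp)
qed

text \<open>The expression is the determinant of a covariance matrix after a rank-one update along
  the vector \<open>(\<alpha>, \<beta>)\<close>. The added form is nonnegative, since
  \<open>a\<close> times it is a sum of squares with nonnegative coefficients.\<close>

lemma binormal_det_pos:
  fixes a b c s \<alpha> \<beta> :: real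
  assumes "0 < a" "0 < b" "c\<^sup>2 < a * b" "0 < s"
  shows "a * b - c\<^sup>2 + s * (b * \<alpha>\<^sup>2 - 2 * c * \<alpha> * \<beta> + a * \<beta>\<^sup>2) > 0"
proof -
  have "a * (b * \<alpha>\<^sup>2 - 2 * c * \<alpha> * \<beta> + a * \<beta>\<^sup>2) = (a * \<beta> - c * \<alpha>)\<^sup>2 + (a * b - c\<^sup>2) * \<alpha>\<^sup>2"
    by (simp add: power2_eq_square algebra_simps)
  also have "\<dots> \<ge> 0" using assms by simp
  finally have "0 \<le> b * \<alpha>\<^sup>2 - 2 * c * \<alpha> * \<beta> + a * \<beta>\<^sup>2"
    using assms by (simp add: zero_le_mult_iff)
  with assms show ?thesis by (simp add: add_pos_nonneg)
qed

text \<open>Adding an independent Gaussian multiple of a fixed vector to a bivariate normal vector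
  adds a rank-one matrix to the covariance. In the integral this amounts to completing the square in
  \<open>x\<close> and identifying what is left.\<close>

lemma binormal_density_conv_normal:
  fixes a b c s u v \<alpha> \<beta> :: real
  assumes ab: "0 < a" "0 < b" "c\<^sup>2 < a * b" and s: "0 < s"
  shows "(\<integral>\<^sup>+x. ennreal (binormal_density a b c (u - x * \<alpha>) (v - x * \<beta>)) \<partial>gaussian 0 s)
    = ennreal (binormal_density (a + s * \<alpha>\<^sup>2) (b + s * \<beta>\<^sup>2) (c + s * \<alpha> * \<beta>) u v)"
proof -
  define \<Delta> where "\<Delta> = a * b - c\<^sup>2"
  \<comment> \<open>\<open>q\<close>, \<open>w\<close> and \<open>r\<close> are the values of the
    adjugate form of the covariance matrix at \<open>(\<alpha>, \<beta>)\<close>, at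
    \<open>(u, v)\<close> and at this pair of vectors, so
    \<open>q * x\<^sup>2 - 2 * r * x + w\<close> is its value at the shifted point.\<close>
  define q where "q = b * \<alpha>\<^sup>2 - 2 * c * \<alpha> * \<beta> + a * \<beta>\<^sup>2"
  define r where "r = b * u * \<alpha> - c * (u * \<beta> + v * \<alpha>) + a * v * \<beta>"
  define w where "w = b * u\<^sup>2 - 2 * c * u * v + a * v\<^sup>2"
  define \<Delta>' where "\<Delta>' = \<Delta> + s * q"
  have \<Delta>: "0 < \<Delta>" using ab by (simp add: \<Delta>_def)
  have \<Delta>': "0 < \<Delta>'" using binormal_det_pos[OF ab s, of \<alpha> \<beta>] by (simp add: \<Delta>'_def \<Delta>_def q_def)
  define A where "A = \<Delta>' / (s * \<Delta>)"
  define B where "B = r / \<Delta>"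
  define C where "C = w / \<Delta>"
  have A: "0 < A" using \<Delta> \<Delta>' s by (simp add: A_def)
  define k where "k = 1 / (2 * pi * sqrt \<Delta>) * (1 / sqrt (2 * pi * s))"
  have k: "0 \<le> k" using \<Delta> s by (simp add: k_def)
  have eq: "normal_density 0 (sqrt s) x * binormal_density a b c (u - x * \<alpha>) (v - x * \<beta>)
      = k * exp (- (A * x\<^sup>2 - 2 * B * x + C) / 2)" for x
  proof -
    have q': "b * (u - x * \<alpha>)\<^sup>2 - 2 * c * (u - x * \<alpha>) * (v - x * \<beta>) + a * (v - x * \<beta>)\<^sup>2
       = q * x\<^sup>2 - 2 * r * x + w"
      by (simp add: q_def r_def w_def power2_eq_square algebra_simps)
    have "- x\<^sup>2 / (2 * s) + - ((q * x\<^sup>2 - 2 * r * x + w) / \<Delta>) / 2 = - (A * x\<^sup>2 - 2 * B * x + C) / 2"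
      using \<Delta> s by (simp add: A_def B_def C_def \<Delta>'_def field_simps)
    then have "exp (- x\<^sup>2 / (2 * s)) * exp (- ((q * x\<^sup>2 - 2 * r * x + w) / \<Delta>) / 2)
       = exp (- (A * x\<^sup>2 - 2 * B * x + C) / 2)"
      by (simp add: exp_add [symmetric])
    then show ?thesis
      using s by (simp add: normal_density_def binormal_density_def q' \<Delta>_def[symmetric] k_def)
  qed
  have "(\<integral>\<^sup>+x. ennreal (binormal_density a b c (u - x * \<alpha>) (v - x * \<beta>)) \<partial>gaussian 0 s)
    = (\<integral>\<^sup>+x. ennreal k * ennreal (exp (- (A * x\<^sup>2 - 2 * B * x + C) / 2)) \<partial>lborel)"
    unfolding gaussian_def
    by (subst nn_integral_density) (auto simp: eq ennreal_mult [symmetric] k ennreal_mult'[symmetric])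
  also have "\<dots> = ennreal (k * (sqrt (2 * pi / A) * exp (- (C - B\<^sup>2 / A) / 2)))"
    using k A by (subst nn_integral_cmult, simp, subst nn_integral_exp_quadratic) (simp_all add: ennreal_mult)
  also have "k * (sqrt (2 * pi / A) * exp (- (C - B\<^sup>2 / A) / 2))
     = binormal_density (a + s * \<alpha>\<^sup>2) (b + s * \<beta>\<^sup>2) (c + s * \<alpha> * \<beta>) u v"
  proof -
    have det: "(a + s * \<alpha>\<^sup>2) * (b + s * \<beta>\<^sup>2) - (c + s * \<alpha> * \<beta>)\<^sup>2 = \<Delta>'"
      by (simp add: \<Delta>'_def \<Delta>_def q_def power2_eq_square algebra_simps)
    have "k * sqrt (2 * pi / A) = 1 / (2 * pi * sqrt \<Delta>')"
      using \<Delta> \<Delta>' s by (simp add: k_def A_def real_sqrt_mult real_sqrt_divide)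
    moreover have "C - B\<^sup>2 / A = ((b + s * \<beta>\<^sup>2) * u\<^sup>2 - 2 * (c + s * \<alpha> * \<beta>) * u * v + (a + s * \<alpha>\<^sup>2) * v\<^sup>2) / \<Delta>'"
    proof -
      \<comment> \<open>The Gram determinant of two plane vectors is the determinant of the form,
        here \<open>\<Delta>\<close>, times the squared determinant of the vectors.\<close>
      have "q * w - r\<^sup>2 = \<Delta> * (\<alpha> * v - \<beta> * u)\<^sup>2"
        by (simp add: q_def w_def r_def \<Delta>_def power2_eq_square algebra_simps)
      then have "\<Delta> * w + s * (q * w - r\<^sup>2) = \<Delta> * w + s * (\<Delta> * (\<alpha> * v - \<beta> * u)\<^sup>2)"
        by simp
      then have "\<Delta>' * w - s * r\<^sup>2 = \<Delta> * (w + s * (\<alpha> * v - \<beta> * u)\<^sup>2)"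
        by (simp add: \<Delta>'_def algebra_simps)
      moreover have "C - B\<^sup>2 / A = (\<Delta>' * w - s * r\<^sup>2) / (\<Delta> * \<Delta>')"
        using \<Delta> \<Delta>' s by (simp add: A_def B_def C_def field_simps power2_eq_square)
      moreover have "w + s * (\<alpha> * v - \<beta> * u)\<^sup>2
          = (b + s * \<beta>\<^sup>2) * u\<^sup>2 - 2 * (c + s * \<alpha> * \<beta>) * u * v + (a + s * \<alpha>\<^sup>2) * v\<^sup>2"
        by (simp add: w_def power2_eq_square algebra_simps)
      ultimately show ?thesis using \<Delta> by simp
    qed
    ultimately show ?thesis
      by (simp only: binormal_density_def det mult.assoc [symmetric]) simp
  qed
  finally show ?thesis .
qed

section \<open>Gaussian vectors and their inner products\<close>

lemma normal_density_eq_centered: "normal_density m \<sigma> x = normal_density 0 \<sigma> (x - m)"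
  by (simp add: normal_density_def)

lemma normal_density_measurable [measurable (raw)]:
  assumes [measurable]: "m \<in> borel_measurable M" "\<sigma> \<in> borel_measurable M" "x \<in> borel_measurable M"
  shows "(\<lambda>\<omega>. normal_density (m \<omega>) (\<sigma> \<omega>) (x \<omega>)) \<in> borel_measurable M"
  unfolding normal_density_def by measurable

definition gaussian_vector :: "real \<Rightarrow> (real ^ 'n) measure" where
  "gaussian_vector s = distr (\<Pi>\<^sub>M i\<in>UNIV. gaussian 0 s) borel (\<lambda>f. \<chi> i. f i)"

lemma sets_gaussian [measurable_cong, simp]: "sets (gaussian m s) = sets borel"
  by (simp add: gaussian_def)

lemma space_gaussian [simp]: "space (gaussian m s) = UNIV"
  by (simp add: gaussian_def)

lemma prob_space_gaussian: "0 < s \<Longrightarrow> prob_space (gaussian m s)"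
  unfolding gaussian_def by (rule prob_space_normal_density) simp

lemma measurable_vec_lambda_PiM [measurable]:
  fixes N :: "'n::finite \<Rightarrow> real measure"
  assumes [measurable_cong]: "\<And>i. sets (N i) = sets borel"
  shows "(\<lambda>f. \<chi> i. f i :: real ^ 'n) \<in> borel_measurable (\<Pi>\<^sub>M i\<in>UNIV. N i)"
proof -
  have "(\<lambda>f. f i) \<in> borel_measurable (\<Pi>\<^sub>M i\<in>UNIV. N i)" for i
    using measurable_component_singleton[of i UNIV N] assms by (simp cong: measurable_cong_sets)
  then show ?thesis
    by (intro borel_measurable_euclidean_space [THEN iffD2]) (auto simp: Basis_vec_def inner_axis)
qed

lemma sets_gaussian_vector [measurable_cong, simp]: "sets (gaussian_vector s) = sets borel"
  by (simp add: gaussian_vector_def)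

lemma prob_space_gaussian_vector:
  assumes "0 < s"
  shows "prob_space (gaussian_vector s :: (real ^ 'n) measure)"
proof -
  interpret product_prob_space "\<lambda>_. gaussian 0 s" "UNIV :: 'n set"
    using assms by (intro product_prob_spaceI prob_space_gaussian)
  show ?thesis
    unfolding gaussian_vector_def by (intro P.prob_space_distr) measurable
qed

text \<open>The integrand starts as the joint density of two independent noises of variance
  \<open>t\<close>, and each coordinate integrated out is one use of
  \<open>binormal_density_conv_normal\<close>. Nondegeneracy is proved in the same induction because
  every step relies on it.\<close>

lemma nn_integral_PiM_gaussian_binormal_density:
  fixes p q :: "'i \<Rightarrow> real"
  assumes "finite I" "0 < t" "0 < s"
  defines "a \<equiv> t + s * (\<Sum>i\<in>I. (p i)\<^sup>2)" and "b \<equiv> t + s * (\<Sum>i\<in>I. (q i)\<^sup>2)"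
    and "c \<equiv> s * (\<Sum>i\<in>I. p i * q i)"
  shows "c\<^sup>2 < a * b"
    and "(\<integral>\<^sup>+f. ennreal (binormal_density t t 0 (u - (\<Sum>i\<in>I. f i * p i)) (v - (\<Sum>i\<in>I. f i * q i)))
          \<partial>(\<Pi>\<^sub>M i\<in>I. gaussian 0 s)) = ennreal (binormal_density a b c u v)"
proof -
  interpret product_prob_space "\<lambda>_. gaussian 0 s" "I :: 'i set"
    using assms by (intro product_prob_spaceI prob_space_gaussian)
  \<comment> \<open>The abbreviations are unfolded because they depend on the index set.
    \<open>u\<close> and \<open>v\<close> are quantified because the induction hypothesis is needed
    at points shifted by the new coordinate.\<close>
  have "(s * (\<Sum>i\<in>I. p i * q i))\<^sup>2 < (t + s * (\<Sum>i\<in>I. (p i)\<^sup>2)) * (t + s * (\<Sum>i\<in>I. (q i)\<^sup>2)) \<and>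
    (\<forall>u v. (\<integral>\<^sup>+f. ennreal (binormal_density t t 0 (u - (\<Sum>i\<in>I. f i * p i)) (v - (\<Sum>i\<in>I. f i * q i)))
          \<partial>(\<Pi>\<^sub>M i\<in>I. gaussian 0 s)) = ennreal (binormal_density (t + s * (\<Sum>i\<in>I. (p i)\<^sup>2))
             (t + s * (\<Sum>i\<in>I. (q i)\<^sup>2)) (s * (\<Sum>i\<in>I. p i * q i)) u v))"
    using \<open>finite I\<close>
  proof (induction I)
    case empty
    show ?case using \<open>0 < t\<close> by (simp add: PiM_empty nn_integral_count_space_finite)
  next
    case (insert i I)
    let ?a = "t + s * (\<Sum>i\<in>I. (p i)\<^sup>2)" and ?b = "t + s * (\<Sum>i\<in>I. (q i)\<^sup>2)"
    let ?c = "s * (\<Sum>i\<in>I. p i * q i)"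
    have pos: "0 < ?a" "0 < ?b" "?c\<^sup>2 < ?a * ?b"
      using insert.IH \<open>0 < t\<close> \<open>0 < s\<close> by (auto intro!: add_pos_nonneg mult_nonneg_nonneg sum_nonneg)
    have "?a * ?b - ?c\<^sup>2 + s * (?b * (p i)\<^sup>2 - 2 * ?c * p i * q i + ?a * (q i)\<^sup>2) > 0"
      by (rule binormal_det_pos) (use pos \<open>0 < s\<close> in auto)
    then have 1: "(?c + s * p i * q i)\<^sup>2 < (?a + s * (p i)\<^sup>2) * (?b + s * (q i)\<^sup>2)"
      by (simp add: power2_eq_square algebra_simps)
    have [measurable]: "(\<lambda>f. f j) \<in> borel_measurable (\<Pi>\<^sub>M i\<in>J. gaussian 0 s)" if "j \<in> J" for j and J :: "'i set"
      using measurable_component_singleton[OF that, of "\<lambda>_. gaussian 0 s"] by (simp cong: measurable_cong_sets)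
    have [measurable]: "(\<lambda>f. \<Sum>j\<in>K. f j * r j) \<in> borel_measurable (\<Pi>\<^sub>M i\<in>J. gaussian 0 s)"
      if "K \<subseteq> J" for K J :: "'i set" and r
      by (intro borel_measurable_sum borel_measurable_times) (use that in auto)
    have 2: "(\<integral>\<^sup>+f. ennreal (binormal_density t t 0 (u - (\<Sum>j\<in>insert i I. f j * p j)) (v - (\<Sum>j\<in>insert i I. f j * q j)))
          \<partial>(\<Pi>\<^sub>M i\<in>insert i I. gaussian 0 s))
       = ennreal (binormal_density (?a + s * (p i)\<^sup>2) (?b + s * (q i)\<^sup>2) (?c + s * p i * q i) u v)" for u v
    proof -
      have upd: "(\<Sum>j\<in>I. (if j = i then x else f j) * r j) = (\<Sum>j\<in>I. f j * r j)" for f x and r :: "'i \<Rightarrow> real"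
        using insert by (intro sum.cong) auto
      have "(\<integral>\<^sup>+f. ennreal (binormal_density t t 0 (u - (\<Sum>j\<in>insert i I. f j * p j)) (v - (\<Sum>j\<in>insert i I. f j * q j)))
          \<partial>(\<Pi>\<^sub>M i\<in>insert i I. gaussian 0 s))
        = (\<integral>\<^sup>+x. \<integral>\<^sup>+f. ennreal (binormal_density t t 0
             (u - x * p i - (\<Sum>j\<in>I. f j * p j)) (v - x * q i - (\<Sum>j\<in>I. f j * q j)))
            \<partial>(\<Pi>\<^sub>M i\<in>I. gaussian 0 s) \<partial>gaussian 0 s)"
        using insert.hyps
        by (subst product_nn_integral_insert_rev) (auto simp: upd diff_diff_eq)
      also have "\<dots> = (\<integral>\<^sup>+x. ennreal (binormal_density ?a ?b ?c (u - x * p i) (v - x * q i)) \<partial>gaussian 0 s)"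
        using insert.IH by simp
      also have "\<dots> = ennreal (binormal_density (?a + s * (p i)\<^sup>2) (?b + s * (q i)\<^sup>2) (?c + s * p i * q i) u v)"
        by (intro binormal_density_conv_normal pos \<open>0 < s\<close>)
      finally show ?thesis .
    qed
    show ?case
      using 1 2 insert.hyps by (simp add: algebra_simps)
  qed
  then show "c\<^sup>2 < a * b"
    and "(\<integral>\<^sup>+f. ennreal (binormal_density t t 0 (u - (\<Sum>i\<in>I. f i * p i)) (v - (\<Sum>i\<in>I. f i * q i)))
          \<partial>(\<Pi>\<^sub>M i\<in>I. gaussian 0 s)) = ennreal (binormal_density a b c u v)"
    by (auto simp: a_def b_def c_def)
qed

lemma power2_norm_vec: "(norm z)\<^sup>2 = (\<Sum>i\<in>UNIV. (z $ i)\<^sup>2)" for z :: "real ^ 'n"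
  unfolding power2_norm_eq_inner by (simp add: inner_vec_def power2_eq_square)

text \<open>For fixed \<open>\<theta>\<close> the two factors describe independent observations of
  \<open>x\<close> and \<open>x'\<close>; averaging over the shared \<open>\<theta>\<close> is what
  creates the covariance.\<close>

lemma nn_integral_gaussian_vector_binormal_density:
  fixes x x' :: "real ^ 'n"
  assumes "0 < t" "0 < s"
  shows "(\<integral>\<^sup>+\<theta>. ennreal (normal_density (\<theta> \<bullet> x) (sqrt t) u) * ennreal (normal_density (\<theta> \<bullet> x') (sqrt t) v) \<partial>gaussian_vector s)
    = ennreal (binormal_density (t + s * (norm x)\<^sup>2) (t + s * (norm x')\<^sup>2) (s * (x \<bullet> x')) u v)"
proof -
  have *: "ennreal (normal_density (\<theta> \<bullet> x) (sqrt t) u) * ennreal (normal_density (\<theta> \<bullet> x') (sqrt t) v)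
     = ennreal (binormal_density t t 0 (u - \<theta> \<bullet> x) (v - \<theta> \<bullet> x'))" for \<theta>
    using assms by (simp add: binormal_density_independent ennreal_mult'' [symmetric]
      normal_density_eq_centered [of "\<theta> \<bullet> x"] normal_density_eq_centered [of "\<theta> \<bullet> x'"])
  show ?thesis
    unfolding * gaussian_vector_def
    using nn_integral_PiM_gaussian_binormal_density(2)
        [where I = UNIV and p = "($) x" and q = "($) x'" and t = t and s = s and u = u and v = v] assms
    by (subst nn_integral_distr) (simp_all add: inner_vec_def power2_norm_vec)
qed

lemma nn_integral_gaussian_vector_normal_density:
  fixes x :: "real ^ 'n"
  assumes "0 < t" "0 < s"
  shows "(\<integral>\<^sup>+\<theta>. ennreal (normal_density (\<theta> \<bullet> x) (sqrt t) u) \<partial>gaussian_vector s)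
    = ennreal (normal_density 0 (sqrt (t + s * (norm x)\<^sup>2)) u)"
proof -
  \<comment> \<open>This is the case \<open>x' = 0\<close> of the bivariate formula.\<close>
  let ?k = "ennreal (normal_density 0 (sqrt t) 0)"
  have pos: "0 < t + s * (norm x)\<^sup>2" using assms by (intro add_pos_nonneg) auto
  have "(\<integral>\<^sup>+\<theta>. ennreal (normal_density (\<theta> \<bullet> x) (sqrt t) u) \<partial>gaussian_vector s) * ?k
     = (\<integral>\<^sup>+\<theta>. ennreal (normal_density (\<theta> \<bullet> x) (sqrt t) u) * ennreal (normal_density (\<theta> \<bullet> 0) (sqrt t) 0) \<partial>gaussian_vector s)"
    by (subst nn_integral_multc [symmetric]) simp_all
  also have "\<dots> = ennreal (normal_density 0 (sqrt (t + s * (norm x)\<^sup>2)) u) * ?k"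
    using assms pos by (subst nn_integral_gaussian_vector_binormal_density)
      (simp_all add: binormal_density_independent ennreal_mult)
  finally show ?thesis
    using assms normal_density_pos[of "sqrt t" 0 0]
    by (simp add: mult.commute[of _ ?k] ennreal_mult_cancel_left)
qed

section \<open>Weighted integrals along the diagonal\<close>

lemma normal_density_second_moment:
  assumes "0 < \<sigma>"
  shows "has_bochner_integral lborel (\<lambda>x. normal_density 0 \<sigma> x * x\<^sup>2) (\<sigma>\<^sup>2)"
  using normal_moment_even[of \<sigma> 0 1] assms by simp

text \<open>On the diagonal the density factors into the density at \<open>0\<close> of the
  difference of the coordinates, whose variance is \<open>a + b - 2 * c\<close>, and the normal
  density of their common value, whose variance is the determinant divided by
  \<open>a + b - 2 * c\<close>. The weight only adds a second moment.\<close>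

lemma nn_integral_weighted_binormal_diagonal:
  fixes a b c t :: real
  assumes "0 < a * b - c\<^sup>2" "0 < a + b - 2 * c" "0 < t"
  shows "(\<integral>\<^sup>+y. ennreal (1 + y\<^sup>2 / t) * ennreal (binormal_density a b c y y) \<partial>lborel)
    = ennreal ((1 + (a * b - c\<^sup>2) / (a + b - 2 * c) / t) / sqrt (2 * pi * (a + b - 2 * c)))"
proof -
  define \<Delta> where "\<Delta> = a * b - c\<^sup>2"
  define D where "D = a + b - 2 * c"
  have pos: "0 < \<Delta>" "0 < D" using assms by (simp_all add: \<Delta>_def D_def)
  let ?\<phi> = "normal_density 0 (sqrt (\<Delta> / D))"
  have eq: "(1 + y\<^sup>2 / t) * binormal_density a b c y y
     = (?\<phi> y + ?\<phi> y * y\<^sup>2 / t) / sqrt (2 * pi * D)" for y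
  proof -
    have "- ((b * y\<^sup>2 - 2 * c * y * y + a * y\<^sup>2) / \<Delta>) / 2 = - y\<^sup>2 / (2 * (\<Delta> / D))"
      using pos by (simp add: D_def power2_eq_square field_simps)
    moreover have "sqrt (2 * pi * (\<Delta> / D)) * sqrt (2 * pi * D) = sqrt ((2 * pi)\<^sup>2 * \<Delta>)"
      using pos by (simp add: real_sqrt_mult [symmetric] power2_eq_square)
    then have "sqrt (2 * pi * (\<Delta> / D)) * sqrt (2 * pi * D) = 2 * pi * sqrt \<Delta>"
      by (simp only: real_sqrt_mult [of "(2 * pi)\<^sup>2"] real_sqrt_abs) simp
    ultimately have "binormal_density a b c y y = ?\<phi> y / sqrt (2 * pi * D)"
      using pos by (simp add: binormal_density_def normal_density_def \<Delta>_def [symmetric])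
    then show ?thesis by (simp add: field_simps)
  qed
  have int: "has_bochner_integral lborel (\<lambda>y. (?\<phi> y + ?\<phi> y * y\<^sup>2 / t) / sqrt (2 * pi * D))
     ((1 + (sqrt (\<Delta> / D))\<^sup>2 / t) / sqrt (2 * pi * D))"
    using pos
    by (intro has_bochner_integral_divide_zero has_bochner_integral_add normal_density_second_moment)
       (simp_all add: has_bochner_integral_iff)
  have "(\<integral>\<^sup>+y. ennreal (1 + y\<^sup>2 / t) * ennreal (binormal_density a b c y y) \<partial>lborel)
     = (\<integral>\<^sup>+y. ennreal ((?\<phi> y + ?\<phi> y * y\<^sup>2 / t) / sqrt (2 * pi * D)) \<partial>lborel)"
    unfolding eq [symmetric]
    using \<open>0 < t\<close> by (intro nn_integral_cong ennreal_mult' [symmetric] add_nonneg_nonneg) auto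
  also have "\<dots> = ennreal ((1 + (sqrt (\<Delta> / D))\<^sup>2 / t) / sqrt (2 * pi * D))"
    using int pos \<open>0 < t\<close> by (subst nn_integral_eq_integral) (auto simp: has_bochner_integral_iff)
  finally show ?thesis
    using pos by (simp add: \<Delta>_def D_def)
qed

text \<open>Replacing the covariance \<open>c\<close> by \<open>0\<close> costs an error linear in
  \<open>\<bar>c\<bar>\<close>. After removal of the factor \<open>sqrt (2 * pi)\<close> the claim
  is rational in the roots \<open>r\<close>, \<open>R\<close>, \<open>m\<close>. For
  \<open>c \<le> 0\<close> both terms are monotone; for positive \<open>c\<close> each of them
  contributes at most \<open>c / m ^ 3\<close>.\<close>

lemma weighted_binormal_diagonal_le:
  fixes a b c t :: real
  assumes t: "0 < t" and ab: "0 < a" "0 < b" and det: "c\<^sup>2 < a * b" and D: "t \<le> a + b - 2 * c" "t \<le> a + b"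
  shows "(1 + (a * b - c\<^sup>2) / (a + b - 2 * c) / t) / sqrt (2 * pi * (a + b - 2 * c))
    \<le> (1 + a * b / (a + b) / t) / sqrt (2 * pi * (a + b)) + 2 * \<bar>c\<bar> / (t * sqrt (2 * pi * t))"
proof -
  define r R m where "r = sqrt (a + b - 2 * c)" and "R = sqrt (a + b)" and "m = sqrt t"
  have m: "0 < m" "m \<le> r" "m \<le> R" using t D by (auto simp: m_def r_def R_def)
  then have pos: "0 < r" "0 < R" by auto
  have sq: "r\<^sup>2 = a + b - 2 * c" "R\<^sup>2 = a + b" "m\<^sup>2 = t"
    using t D by (auto simp: m_def r_def R_def)
  have c: "2 * c = R\<^sup>2 - r\<^sup>2" by (simp add: sq)
  have "1 / r + (a * b - c\<^sup>2) / r ^ 3 / m\<^sup>2 \<le> 1 / R + a * b / R ^ 3 / m\<^sup>2 + 2 * \<bar>c\<bar> / m ^ 3"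
  proof (cases "c \<le> 0")
    case True
    then have "R \<le> r" by (auto simp: r_def R_def)
    then have "1 / r \<le> 1 / R" "(a * b - c\<^sup>2) / r ^ 3 \<le> a * b / R ^ 3"
      using pos ab det by (auto intro!: frac_le power_mono)
    moreover from this(2) have "(a * b - c\<^sup>2) / r ^ 3 / m\<^sup>2 \<le> a * b / R ^ 3 / m\<^sup>2"
      by (rule divide_right_mono) simp
    moreover have "0 \<le> 2 * \<bar>c\<bar> / m ^ 3" using m by simp
    ultimately show ?thesis by linarith
  next
    case False
    then have "r \<le> R" by (auto simp: r_def R_def)
    have "1 / r - 1 / R \<le> c / m ^ 3"
    proof -
      have "1 / r - 1 / R = 2 * c / (r * R * (R + r))"
      proof -
        have "2 * c = (R - r) * (R + r)" unfolding c by (simp add: power2_eq_square algebra_simps)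
        then have "2 * c / (r * R * (R + r)) = (R - r) / (r * R)"
          using pos by simp
        then show ?thesis using pos by (simp add: diff_divide_distrib)
      qed
      also have "\<dots> \<le> 2 * c / (m * m * (m + m))"
        using False m pos by (intro divide_left_mono mult_mono add_mono mult_pos_pos) auto
      finally show ?thesis by (simp add: power3_eq_cube)
    qed
    moreover have "(a * b - c\<^sup>2) / r ^ 3 - a * b / R ^ 3 \<le> c / m"
    proof -
      \<comment> \<open>As \<open>1 / r ^ 3 - 1 / R ^ 3\<close> is nonnegative, \<open>a * b\<close>
        may be replaced by its maximum for the given sum \<open>a + b = R\<^sup>2\<close>, which is
        attained at \<open>a = b\<close>.\<close>
      have "4 * (a * b) \<le> (R\<^sup>2)\<^sup>2"
        using zero_le_power2[of "a - b"] unfolding sq by (simp add: power2_eq_square algebra_simps)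
      moreover have "1 / R ^ 3 \<le> 1 / r ^ 3"
        using pos \<open>r \<le> R\<close> by (intro divide_left_mono power_mono) auto
      ultimately have "(a * b) * (1 / r ^ 3 - 1 / R ^ 3) \<le> ((R\<^sup>2)\<^sup>2 / 4) * (1 / r ^ 3 - 1 / R ^ 3)"
        by (intro mult_right_mono) auto
      then have "(a * b - c\<^sup>2) / r ^ 3 - a * b / R ^ 3 \<le> ((R\<^sup>2)\<^sup>2 / 4 - c\<^sup>2) / r ^ 3 - (R\<^sup>2)\<^sup>2 / 4 / R ^ 3"
        by (simp add: right_diff_distrib diff_divide_distrib)
      also have "(R\<^sup>2)\<^sup>2 / 4 - c\<^sup>2 = r\<^sup>2 * (r\<^sup>2 + 4 * c) / 4"
      proof -
        have R2: "R\<^sup>2 = r\<^sup>2 + 2 * c" using c by simp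
        show ?thesis unfolding R2 by (simp add: power2_eq_square field_simps)
      qed
      also have "(r\<^sup>2 * (r\<^sup>2 + 4 * c) / 4) / r ^ 3 - (R\<^sup>2)\<^sup>2 / 4 / R ^ 3 = r / 4 + c / r - R / 4"
        using pos by (simp add: field_simps power2_eq_square power3_eq_cube)
      also have "\<dots> \<le> c / r" using \<open>r \<le> R\<close> by simp
      also have "\<dots> \<le> c / m" using False m pos by (intro divide_left_mono) auto
      finally show ?thesis .
    qed
    then have "((a * b - c\<^sup>2) / r ^ 3 - a * b / R ^ 3) / m\<^sup>2 \<le> c / m / m\<^sup>2"
      by (rule divide_right_mono) simp
    moreover have "c / m / m\<^sup>2 = c / m ^ 3" by (simp add: power2_eq_square power3_eq_cube)
    ultimately show ?thesis using False by (simp add: diff_divide_distrib)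
  qed
  then have ineq: "(1 / r + (a * b - c\<^sup>2) / r ^ 3 / m\<^sup>2) / sqrt (2 * pi)
     \<le> (1 / R + a * b / R ^ 3 / m\<^sup>2 + 2 * \<bar>c\<bar> / m ^ 3) / sqrt (2 * pi)"
    by (rule divide_right_mono) simp
  have e1: "(1 + (a * b - c\<^sup>2) / (a + b - 2 * c) / t) / sqrt (2 * pi * (a + b - 2 * c))
      = (1 / r + (a * b - c\<^sup>2) / r ^ 3 / m\<^sup>2) / sqrt (2 * pi)"
    unfolding sq(1)[symmetric] sq(3)[symmetric] using pos m
    by (simp add: real_sqrt_mult field_simps power2_eq_square power3_eq_cube)
  have e2: "(1 + a * b / (a + b) / t) / sqrt (2 * pi * (a + b))
      = (1 / R + a * b / R ^ 3 / m\<^sup>2) / sqrt (2 * pi)"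
    unfolding sq(2)[symmetric] sq(3)[symmetric] using pos m
    by (simp add: real_sqrt_mult field_simps power2_eq_square power3_eq_cube)
  have e3: "2 * \<bar>c\<bar> / (t * sqrt (2 * pi * t)) = (2 * \<bar>c\<bar> / m ^ 3) / sqrt (2 * pi)"
    unfolding sq(3)[symmetric] using m
    by (simp add: real_sqrt_mult field_simps power2_eq_square power3_eq_cube)
  show ?thesis using ineq unfolding e1 e2 e3 by (simp only: add_divide_distrib)
qed

text \<open>The integral of \<open>1 / (1 + x\<^sup>2)\<close> is \<open>pi\<close>, and scaling by
  \<open>sqrt s\<close> does the rest. The inverse weight contributes this factor to the
  Cauchy--Schwarz estimate.\<close>

lemma nn_integral_inverse_weight:
  assumes "0 < (s::real)"
  shows "(\<integral>\<^sup>+y. ennreal (1 / (1 + y\<^sup>2 / s)) \<partial>lborel) = ennreal (pi * sqrt s)"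
proof -
  have "(\<integral>\<^sup>+x. ennreal (inverse (1 + x\<^sup>2)) \<partial>lborel) = ennreal (\<integral>x. inverse (1 + x\<^sup>2) \<partial>lborel)"
    using integrable_inverse_1_plus_square
    by (intro nn_integral_eq_integral) (auto simp: set_integrable_def)
  also have "(\<integral>x. inverse (1 + x\<^sup>2) \<partial>lborel) = pi"
    using LBINT_inverse_1_plus_square
    by (simp add: interval_lebesgue_integral_def set_lebesgue_integral_def)
  finally have "(\<integral>\<^sup>+x. ennreal (inverse (1 + x\<^sup>2)) \<partial>lborel) = ennreal pi" .
  then show ?thesis
    using assms
    by (subst nn_integral_real_affine[where c = "sqrt s" and t = 0])
       (simp_all add: power_mult_distrib inverse_eq_divide ennreal_mult'' [symmetric] mult.commute)
qed

subsection \<open>Relative entropy of densities\<close>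

text \<open>The correction \<open>- x + y\<close> integrates to \<open>0\<close> for probability densities and makes the
integrand nonnegative, so that Tonelli applies without integrability conditions.\<close>

definition kl_term :: "real \<Rightarrow> real \<Rightarrow> real" where
  "kl_term x y = x * ln (x / y) - x + y"

lemma kl_term_measurable [measurable (raw)]:
  assumes [measurable]: "f \<in> borel_measurable M" "g \<in> borel_measurable M"
  shows "(\<lambda>x. kl_term (f x) (g x)) \<in> borel_measurable M"
  unfolding kl_term_def by measurable

text \<open>The concave \<open>ln\<close> lies below its tangent at \<open>m\<close>, a point left
  free for optimization. The bound contains \<open>x\<close> only to the first and second power, so
  its mean is determined by two moments.\<close>

lemma kl_term_le_tangent:
  assumes "0 < x" "0 < y" "0 < m"
  shows "kl_term x y \<le> x * ln (m / y) + x\<^sup>2 / m - 2 * x + y"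
proof -
  have "x * ln (x / m) \<le> x * (x / m - 1)"
    using assms by (intro mult_left_mono ln_le_minus_one) auto
  moreover have "ln (x / y) = ln (x / m) + ln (m / y)"
    using assms by (simp add: ln_div)
  ultimately show ?thesis
    by (simp add: kl_term_def algebra_simps power2_eq_square)
qed

text \<open>Convexity in the first argument: the tangent at \<open>m\<close> has slope
  \<open>ln (m / y)\<close>.\<close>

lemma kl_term_ge_tangent:
  assumes "0 < x" "0 < y" "0 < m"
  shows "kl_term m y + ln (m / y) * (x - m) \<le> kl_term x y"
proof -
  have "x * ln (m / x) \<le> x * (m / x - 1)"
    using assms by (intro mult_left_mono ln_le_minus_one) auto
  also have "\<dots> = m - x" using assms by (simp add: field_simps)
  finally have "x * ln (m / x) \<le> m - x" .
  moreover have "x * ln (x / y) = x * ln (m / y) - x * ln (m / x)"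
    using assms by (simp add: ln_div algebra_simps)
  ultimately show ?thesis
    by (simp add: kl_term_def algebra_simps)
qed

lemma kl_term_nonneg: "0 < x \<Longrightarrow> 0 < y \<Longrightarrow> 0 \<le> kl_term x y"
  using kl_term_ge_tangent[of x y y] by (simp add: kl_term_def)

lemma kl_term_le: "0 < x \<Longrightarrow> 0 < y \<Longrightarrow> kl_term x y \<le> x\<^sup>2 / y + y"
  using kl_term_le_tangent[of x y y] by simp

text \<open>The logarithms of both densities are quadratic in \<open>y\<close>, so second moments
  give the exact value. The bound is kept linear in \<open>\<bar>S - T\<bar>\<close> so that a first
  absolute moment, namely \<open>alpha\<close>, suffices after averaging over
  \<open>S\<close>.\<close>

lemma nn_integral_kl_term_normal_le:
  assumes "0 < t" "t \<le> S" "t \<le> T"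
  shows "(\<integral>\<^sup>+y. ennreal (kl_term (normal_density 0 (sqrt S) y) (normal_density 0 (sqrt T) y)) \<partial>lborel)
    \<le> ennreal (\<bar>S - T\<bar> / (2 * t))"
proof -
  have pos: "0 < S" "0 < T" using assms by auto
  let ?\<phi> = "normal_density 0 (sqrt S)" and ?\<psi> = "normal_density 0 (sqrt T)"
  have eq: "kl_term (?\<phi> y) (?\<psi> y)
     = ?\<phi> y * (ln (T / S) / 2) + ?\<phi> y * y\<^sup>2 * (1 / (2 * T) - 1 / (2 * S)) - ?\<phi> y + ?\<psi> y" for y
  proof -
    have ln_density: "ln (normal_density 0 (sqrt R) y) = - (ln (2 * pi) + ln R) / 2 - y\<^sup>2 / (2 * R)" if "0 < R" for R
      using that by (simp add: normal_density_def ln_mult ln_div ln_sqrt add_divide_distrib)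
    have "ln (?\<phi> y / ?\<psi> y) = ln (?\<phi> y) - ln (?\<psi> y)"
      using pos by (intro ln_divide_pos normal_density_pos) auto
    then have "ln (?\<phi> y / ?\<psi> y) = ln (T / S) / 2 + y\<^sup>2 * (1 / (2 * T) - 1 / (2 * S))"
      using pos by (simp add: ln_density ln_div diff_divide_distrib add_divide_distrib right_diff_distrib)
    then show ?thesis
      unfolding kl_term_def by (simp only:) (simp add: algebra_simps)
  qed
  have "has_bochner_integral lborel (\<lambda>y. kl_term (?\<phi> y) (?\<psi> y))
     (1 * (ln (T / S) / 2) + (sqrt S)\<^sup>2 * (1 / (2 * T) - 1 / (2 * S)) - 1 + 1)"
    unfolding eq using pos
    by (intro has_bochner_integral_add has_bochner_integral_diff has_bochner_integral_mult_left
          normal_density_second_moment) (simp_all add: has_bochner_integral_iff)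
  then have "(\<integral>\<^sup>+y. ennreal (kl_term (?\<phi> y) (?\<psi> y)) \<partial>lborel)
     = ennreal (ln (T / S) / 2 + S * (1 / (2 * T) - 1 / (2 * S)))"
    using pos by (subst nn_integral_eq_integral) (auto simp: has_bochner_integral_iff intro!: kl_term_nonneg normal_density_pos)
  also have "ln (T / S) / 2 + S * (1 / (2 * T) - 1 / (2 * S)) \<le> \<bar>S - T\<bar> / (2 * t)"
  proof -
    have "ln (T / S) \<le> T / S - 1" using pos by (intro ln_le_minus_one) auto
    then have "ln (T / S) / 2 + S * (1 / (2 * T) - 1 / (2 * S)) \<le> (T / S - 1) / 2 + S * (1 / (2 * T) - 1 / (2 * S))"
      by simp
    \<comment> \<open>The preceding expression is \<open>(S - T)\<^sup>2 / (2 * S * T)\<close>.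
      Splitting \<open>S * T\<close> into maximum and minimum leaves one quotient at most
      \<open>1\<close> and one denominator at least \<open>2 * t\<close>.\<close>
    also have "\<dots> = \<bar>S - T\<bar> * (\<bar>S - T\<bar> / max S T) / (2 * min S T)"
      using pos by (cases "S \<le> T") (auto simp: field_simps)
    also have "\<dots> \<le> \<bar>S - T\<bar> * 1 / (2 * t)"
      using pos assms by (intro frac_le mult_left_mono) (auto simp: field_simps)
    finally show ?thesis by simp
  qed
  finally show ?thesis by (simp add: ennreal_leI)
qed

text \<open>Nothing is to be shown if the right side is infinite. If it is finite,
  \<open>p y * ln (p y / q y)\<close> is integrable, so the finite case of
  \<open>relative_entropy\<close> applies, and the terms \<open>- p y + q y\<close> integrate to
  \<open>0\<close>.\<close>

lemma relative_entropy_density_le: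
  fixes p q :: "real \<Rightarrow> real"
  assumes [measurable]: "p \<in> borel_measurable borel" "q \<in> borel_measurable borel"
    and pos: "\<And>y. 0 < p y" "\<And>y. 0 < q y"
    and int: "has_bochner_integral lborel p 1" "has_bochner_integral lborel q 1"
  shows "relative_entropy (density lborel p) (density lborel q)
    \<le> (\<integral>\<^sup>+y. ennreal (kl_term (p y) (q y)) \<partial>lborel)"
proof (cases "(\<integral>\<^sup>+y. ennreal (kl_term (p y) (q y)) \<partial>lborel) = \<infinity>")
  case False
  let ?P = "density lborel p" and ?Q = "density lborel q"
  have nn: "0 \<le> p y" "0 \<le> q y" "0 \<le> kl_term (p y) (q y)" for y
    using pos[of y] by (auto intro: kl_term_nonneg)
  have int': "integrable lborel (\<lambda>y. kl_term (p y) (q y))"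
    using False nn by (intro integrableI_nonneg) (auto simp: top.not_eq_extremum)
  have "integrable lborel (\<lambda>y. kl_term (p y) (q y) + p y - q y)"
    using int int' by (intro Bochner_Integration.integrable_add Bochner_Integration.integrable_diff)
      (auto simp: has_bochner_integral_iff)
  then have intl: "integrable lborel (\<lambda>y. p y * ln (p y / q y))"
    by (simp add: kl_term_def)
  interpret Q: prob_space ?Q
    using int nn by (intro prob_spaceI)
      (simp add: emeasure_density nn_integral_eq_integral has_bochner_integral_iff)
  have PQ: "?P = density ?Q (\<lambda>y. p y / q y)"
    using pos nn
    by (subst density_density_eq) (auto intro!: density_cong simp: ennreal_mult' [symmetric] less_imp_neq[symmetric])
  have ac: "absolutely_continuous ?Q ?P"
    unfolding PQ by (rule absolutely_continuousI_density) simp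
  have RN: "AE y in ?Q. RN_deriv ?Q ?P y = ennreal (p y / q y)"
  proof -
    have "AE y in ?Q. ennreal (p y / q y) = RN_deriv ?Q ?P y"
      by (rule Q.RN_deriv_unique[OF _ PQ [symmetric]]) simp
    then show ?thesis by eventually_elim simp
  qed
  \<comment> \<open>The Radon--Nikodym derivative is known only almost everywhere for
    \<open>?Q\<close>; absolute continuity carries this over to \<open>?P\<close>, where the entropy
    density is integrated.\<close>
  have ed: "AE y in ?P. entropy_density (exp 1) ?Q ?P y = ln (p y / q y)"
  proof -
    have "AE y in ?P. RN_deriv ?Q ?P y = ennreal (p y / q y)"
      by (rule absolutely_continuous_AE[OF _ ac RN]) simp
    then show ?thesis
      by eventually_elim (use nn in \<open>auto simp: entropy_density_def log_def\<close>)
  qed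
  have m: "entropy_density (exp 1) ?Q ?P \<in> borel_measurable ?P"
    using measurable_entropy_density[of "exp 1" ?Q ?P] by simp
  have "integrable ?P (\<lambda>y. ln (p y / q y))"
    using intl nn by (subst integrable_real_density) auto
  then have "integrable ?P (entropy_density (exp 1) ?Q ?P)"
    using ed m by (subst integrable_cong_AE[OF m _ ed]) auto
  moreover have "KL_divergence (exp 1) ?Q ?P = (\<integral>y. kl_term (p y) (q y) \<partial>lborel)"
  proof -
    have "KL_divergence (exp 1) ?Q ?P = (\<integral>y. ln (p y / q y) \<partial>?P)"
      unfolding KL_divergence_def using ed m by (intro integral_cong_AE) auto
    also have "\<dots> = (\<integral>y. p y * ln (p y / q y) \<partial>lborel)"
      using nn by (subst integral_real_density) auto
    also have "\<dots> = (\<integral>y. kl_term (p y) (q y) \<partial>lborel)"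
      using int intl by (simp add: kl_term_def has_bochner_integral_iff)
    finally show ?thesis .
  qed
  ultimately show ?thesis
    using ac int' nn by (simp add: relative_entropy_def nn_integral_eq_integral)
qed simp

section \<open>Mean entropy of bounded positive random variables\<close>

context prob_space
begin

lemma integrable_bounded_positive:
  fixes Z :: "'a \<Rightarrow> real"
  assumes "Z \<in> borel_measurable M" "\<And>x. 0 < Z x" "\<And>x. Z x \<le> K"
  shows "integrable M Z" "integrable M (\<lambda>x. (Z x)\<^sup>2)" "0 < expectation Z"
    "(expectation Z)\<^sup>2 \<le> expectation (\<lambda>x. (Z x)\<^sup>2)"
proof -
  show 1: "integrable M Z"
    using assms by (intro integrable_const_bound[where B = K]) (auto simp: abs_of_pos)
  show 2: "integrable M (\<lambda>x. (Z x)\<^sup>2)"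
    using assms by (intro integrable_const_bound[where B = "K\<^sup>2"]) (auto intro!: power_mono intro: less_imp_le)
  show "0 < expectation Z"
    using assms by (intro expectation_greater 1) auto
  show "(expectation Z)\<^sup>2 \<le> expectation (\<lambda>x. (Z x)\<^sup>2)"
    using variance_positive[of Z] by (simp add: variance_eq[OF 1 2])
qed

text \<open>Integrating the tangent bound at the best point gives the value at the mean
  \<open>e\<close> plus \<open>e * ln (1 + (v / e)\<^sup>2)\<close>, where \<open>v\<close> is the
  standard deviation of \<open>Z\<close>.\<close>

lemma nn_integral_kl_term_le:
  fixes Z :: "'a \<Rightarrow> real"
  assumes Z: "Z \<in> borel_measurable M" "\<And>x. 0 < Z x" "\<And>x. Z x \<le> K" and "0 < q"
  shows "(\<integral>\<^sup>+x. ennreal (kl_term (Z x) q) \<partial>M)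
    \<le> ennreal (89 / 100 * sqrt (expectation (\<lambda>x. (Z x)\<^sup>2) - (expectation Z)\<^sup>2)) + ennreal (kl_term (expectation Z) q)"
proof -
  note int = integrable_bounded_positive[OF Z]
  define e where "e = expectation Z"
  \<comment> \<open>The minimizer over \<open>m\<close> of the integrated tangent bound. For this
    choice the quadratic term has mean \<open>e\<close>.\<close>
  define m where "m = expectation (\<lambda>x. (Z x)\<^sup>2) / e"
  define v where "v = sqrt (expectation (\<lambda>x. (Z x)\<^sup>2) - e\<^sup>2)"
  have e: "0 < e" using int by (simp add: e_def)
  have E2: "expectation (\<lambda>x. (Z x)\<^sup>2) = e\<^sup>2 + v\<^sup>2" using int(4) by (simp add: v_def e_def)
  have v: "0 \<le> v" using int(4) by (simp add: v_def e_def)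
  have pos: "0 < e\<^sup>2 + v\<^sup>2" using e by (simp add: add_pos_nonneg)
  have m: "0 < m" "m / e = 1 + (v / e)\<^sup>2" "expectation (\<lambda>x. (Z x)\<^sup>2) / m = e"
  proof -
    show "0 < m" using e pos by (simp add: m_def E2)
    have "x / (x / e) = e" if "0 < x" for x using e that by simp
    from this[OF pos] show "expectation (\<lambda>x. (Z x)\<^sup>2) / m = e" unfolding m_def E2 .
    show "m / e = 1 + (v / e)\<^sup>2"
      unfolding m_def E2 using e by (simp add: power2_eq_square add_divide_distrib)
  qed
  have "has_bochner_integral M (\<lambda>x. Z x * ln (m / q) + (Z x)\<^sup>2 / m - 2 * Z x + q)
     (e * ln (m / q) + expectation (\<lambda>x. (Z x)\<^sup>2) / m - 2 * e + q)"
    using int by (intro has_bochner_integral_add has_bochner_integral_diff has_bochner_integral_mult_left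
        has_bochner_integral_mult_right has_bochner_integral_divide_zero)
      (auto simp: has_bochner_integral_iff e_def prob_space)
  moreover have tangent: "kl_term (Z x) q \<le> Z x * ln (m / q) + (Z x)\<^sup>2 / m - 2 * Z x + q" for x
    using m Z \<open>0 < q\<close> by (intro kl_term_le_tangent) auto
  moreover have "0 \<le> kl_term (Z x) q" for x
    using Z \<open>0 < q\<close> by (intro kl_term_nonneg) auto
  ultimately have "(\<integral>\<^sup>+x. ennreal (Z x * ln (m / q) + (Z x)\<^sup>2 / m - 2 * Z x + q) \<partial>M)
      = ennreal (e * ln (m / q) + e - 2 * e + q)"
    using m by (subst nn_integral_eq_integral) (auto simp: has_bochner_integral_iff intro: order_trans)
  then have "(\<integral>\<^sup>+x. ennreal (kl_term (Z x) q) \<partial>M) \<le> ennreal (e * ln (m / q) + e - 2 * e + q)"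
    using tangent by (auto intro: order_trans[OF nn_integral_mono[OF ennreal_leI[OF tangent]]])
  also have "e * ln (m / q) + e - 2 * e + q = e * ln (1 + (v / e)\<^sup>2) + kl_term e q"
  proof -
    have "ln (m / q) = ln (m / e) + ln (e / q)"
      using m(1) e \<open>0 < q\<close> by (simp add: ln_div)
    then show ?thesis unfolding m(2) by (simp add: kl_term_def algebra_simps)
  qed
  also have "\<dots> \<le> 89 / 100 * v + kl_term e q"
  proof -
    \<comment> \<open>A bound linear in \<open>v / e\<close> makes the mean \<open>e\<close> cancel,
      so that only the standard deviation remains.\<close>
    have "e * ln (1 + (v / e)\<^sup>2) \<le> e * (89 / 100 * (v / e))"
      using e v by (intro mult_left_mono ln_one_plus_square_le) auto
    then show ?thesis using e by simp
  qed
  finally show ?thesis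
    using v kl_term_nonneg[OF e \<open>0 < q\<close>] by (simp add: ennreal_leI ennreal_plus[symmetric] v_def e_def del: ennreal_plus)
qed

text \<open>Jensen's inequality for the convex \<open>kl_term\<close>, obtained by integrating its
  tangent at the mean. The bound \<open>K\<close> makes all integrals finite.\<close>

lemma kl_term_expectation_le:
  fixes Z :: "'a \<Rightarrow> real"
  assumes Z: "Z \<in> borel_measurable M" "\<And>x. 0 < Z x" "\<And>x. Z x \<le> K" and "0 < q"
  shows "ennreal (kl_term (expectation Z) q) \<le> (\<integral>\<^sup>+x. ennreal (kl_term (Z x) q) \<partial>M)"
proof -
  note int = integrable_bounded_positive[OF Z]
  define e where "e = expectation Z"
  have e: "0 < e" using int by (simp add: e_def)
  have nn: "0 \<le> kl_term (Z x) q" for x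
    using Z \<open>0 < q\<close> by (intro kl_term_nonneg) auto
  have "integrable M (\<lambda>x. kl_term (Z x) q)"
  proof (rule integrable_const_bound[where B = "K\<^sup>2 / q + q"])
    have "kl_term (Z x) q \<le> K\<^sup>2 / q + q" for x
      using Z \<open>0 < q\<close>
      by (intro order_trans[OF kl_term_le] add_right_mono divide_right_mono power_mono) (auto intro: less_imp_le)
    with nn show "AE x in M. norm (kl_term (Z x) q) \<le> K\<^sup>2 / q + q" by simp
  qed (use Z in measurable)
  moreover have "has_bochner_integral M (\<lambda>x. kl_term e q + ln (e / q) * (Z x - e)) (kl_term e q + ln (e / q) * (e - e))"
    using int by (intro has_bochner_integral_add has_bochner_integral_diff has_bochner_integral_mult_right)
      (auto simp: has_bochner_integral_iff e_def prob_space)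
  moreover have "kl_term e q + ln (e / q) * (Z x - e) \<le> kl_term (Z x) q" for x
    using e Z \<open>0 < q\<close> by (intro kl_term_ge_tangent) auto
  ultimately have "kl_term e q \<le> expectation (\<lambda>x. kl_term (Z x) q)"
    using integral_mono[of M "\<lambda>x. kl_term e q + ln (e / q) * (Z x - e)" "\<lambda>x. kl_term (Z x) q"]
    by (auto simp: has_bochner_integral_iff)
  then show ?thesis
    using \<open>integrable M (\<lambda>x. kl_term (Z x) q)\<close> nn
    by (subst nn_integral_eq_integral) (auto simp: e_def ennreal_leI)
qed

end

subsection \<open>The projected vector with Gaussian noise\<close>

lemma normal_density_le:
  assumes "0 < t" "t \<le> v"
  shows "normal_density m (sqrt v) y \<le> 1 / sqrt (2 * pi * t)"
proof -
  have "normal_density m (sqrt v) y \<le> 1 / sqrt (2 * pi * v)"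
    using assms unfolding normal_density_def by (simp add: divide_right_mono)
  also have "\<dots> \<le> 1 / sqrt (2 * pi * t)"
    using assms by (intro divide_left_mono) auto
  finally show ?thesis .
qed

lemma ennreal_le_if_square_le:
  fixes x :: ennreal
  assumes "x\<^sup>2 \<le> (ennreal r)\<^sup>2" "0 \<le> r"
  shows "x \<le> ennreal r"
  using assms
  by (cases x) (auto simp: ennreal_power power_top_ennreal top_unique intro!: ennreal_leI intro: power2_le_imp_le)

text \<open>\<open>\<nu>\<close> stands for the law of \<open>X\<close>, \<open>s\<close> for the
  variance of the entries of \<open>\<Theta>\<close>, which is \<open>1 / n\<close> in the
  application, and \<open>t\<close> for the variance of the noise.\<close>

locale gaussian_projection = prob_space \<nu>
  for \<nu> :: "(real ^ 'n) measure" +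
  fixes s t :: real
  assumes sets_\<nu> [measurable_cong]: "sets \<nu> = sets borel"
    and s: "0 < s" and t: "0 < t"
    and integrable_norm2: "integrable \<nu> (\<lambda>x. (norm x)\<^sup>2)"
begin

abbreviation G :: "(real ^ 'n) measure" where "G \<equiv> gaussian_vector s"

text \<open>Given \<open>\<Theta> = \<theta>\<close> and \<open>X = x\<close>, \<open>Y\<close> is
  normal with mean \<open>\<theta> \<bullet> x\<close> and variance \<open>t\<close>; averaging over
  \<open>x\<close> leaves the density of \<open>Y\<close> given
  \<open>\<Theta> = \<theta>\<close>.\<close>

definition cond_density :: "real ^ 'n \<Rightarrow> real \<Rightarrow> real" where
  "cond_density \<theta> y = (\<integral>x. normal_density (\<theta> \<bullet> x) (sqrt t) y \<partial>\<nu>)"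

text \<open>The variance of \<open>Y\<close> given \<open>X = x\<close> when \<open>\<Theta>\<close>
  is averaged out.\<close>

definition proj_var :: "real ^ 'n \<Rightarrow> real" where
  "proj_var x = t + s * (norm x)\<^sup>2"

definition mix_density :: "real \<Rightarrow> real" where
  "mix_density y = (\<integral>\<theta>. cond_density \<theta> y \<partial>G)"

definition second_moment :: "real \<Rightarrow> real" where
  "second_moment y = (\<integral>\<theta>. (cond_density \<theta> y)\<^sup>2 \<partial>G)"

sublocale G: prob_space "gaussian_vector s :: (real ^ 'n) measure"
  using s by (rule prob_space_gaussian_vector)

sublocale G\<nu>: pair_sigma_finite G \<nu> ..
sublocale \<nu>\<nu>: pair_sigma_finite \<nu> \<nu> ..
sublocale \<nu>\<nu>: prob_space "\<nu> \<Otimes>\<^sub>M \<nu>" by (intro prob_space_pair prob_space_axioms)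
sublocale \<nu>L: pair_sigma_finite \<nu> lborel ..
sublocale GL: pair_sigma_finite G lborel ..
sublocale G\<nu>\<nu>: pair_sigma_finite G "\<nu> \<Otimes>\<^sub>M \<nu>" ..
sublocale \<nu>\<nu>L: pair_sigma_finite "\<nu> \<Otimes>\<^sub>M \<nu>" lborel ..

lemma cond_density_measurable [measurable]:
  "case_prod cond_density \<in> borel_measurable (borel \<Otimes>\<^sub>M borel)"
  unfolding cond_density_def by measurable

lemma cond_density_measurable' [measurable (raw)]:
  assumes [measurable]: "f \<in> borel_measurable M" "g \<in> borel_measurable M"
  shows "(\<lambda>\<omega>. cond_density (f \<omega>) (g \<omega>)) \<in> borel_measurable M"
  using measurable_compose[OF _ cond_density_measurable, of "\<lambda>\<omega>. (f \<omega>, g \<omega>)" M] by simp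

lemma mix_density_measurable [measurable]: "mix_density \<in> borel_measurable borel"
  unfolding mix_density_def by measurable

lemma second_moment_measurable [measurable]: "second_moment \<in> borel_measurable borel"
  unfolding second_moment_def by measurable

lemma proj_var_measurable [measurable]: "proj_var \<in> borel_measurable borel"
  unfolding proj_var_def by measurable

lemma proj_var_ge: "t \<le> proj_var x"
  using s by (simp add: proj_var_def)

lemma proj_var_pos: "0 < proj_var x"
  using proj_var_ge[of x] t by simp

lemma normal_density_bounds:
  "0 < normal_density (\<theta> \<bullet> x) (sqrt t) y" "normal_density (\<theta> \<bullet> x) (sqrt t) y \<le> 1 / sqrt (2 * pi * t)"
  using t by (auto intro: normal_density_pos normal_density_le)

lemma integrable_normal_density_inner:
  "integrable \<nu> (\<lambda>x. normal_density (\<theta> \<bullet> x) (sqrt t) y)"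
  by (rule integrable_bounded_positive(1)[OF _ normal_density_bounds]) measurable

lemma cond_density_pos: "0 < cond_density \<theta> y"
  unfolding cond_density_def
  by (rule integrable_bounded_positive(3)[OF _ normal_density_bounds]) measurable

lemma cond_density_le: "cond_density \<theta> y \<le> 1 / sqrt (2 * pi * t)"
  unfolding cond_density_def
  by (intro integral_le_const integrable_normal_density_inner AE_I2 normal_density_bounds)

lemma ennreal_cond_density:
  "ennreal (cond_density \<theta> y) = (\<integral>\<^sup>+x. ennreal (normal_density (\<theta> \<bullet> x) (sqrt t) y) \<partial>\<nu>)"
  unfolding cond_density_def
  using integrable_normal_density_inner by (intro nn_integral_eq_integral [symmetric]) auto

lemma has_bochner_integral_cond_density: "has_bochner_integral lborel (cond_density \<theta>) 1"
proof (rule has_bochner_integral_nn_integral)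
  have "(\<integral>\<^sup>+y. ennreal (cond_density \<theta> y) \<partial>lborel)
     = (\<integral>\<^sup>+x. \<integral>\<^sup>+y. ennreal (normal_density (\<theta> \<bullet> x) (sqrt t) y) \<partial>lborel \<partial>\<nu>)"
    unfolding ennreal_cond_density by (rule \<nu>L.Fubini') measurable
  also have "\<dots> = (\<integral>\<^sup>+x. 1 \<partial>\<nu>)"
    using t by (intro nn_integral_cong) (simp add: nn_integral_eq_integral)
  finally show "(\<integral>\<^sup>+y. ennreal (cond_density \<theta> y) \<partial>lborel) = ennreal 1"
    by (simp add: emeasure_space_1)
qed (use cond_density_pos in \<open>auto intro: less_imp_le\<close>)

lemmas cond_density_moments =
  G.integrable_bounded_positive[of "\<lambda>\<theta>. cond_density \<theta> y" "1 / sqrt (2 * pi * t)" for y,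
    OF _ cond_density_pos cond_density_le, simplified]

text \<open>Averaging over \<open>\<theta>\<close> before \<open>x\<close> replaces each normal
  density by a centered one, which exhibits the mean as the mixture to which convexity is
  applied.\<close>

lemma ennreal_mix_density:
  "ennreal (mix_density y) = (\<integral>\<^sup>+x. ennreal (normal_density 0 (sqrt (proj_var x)) y) \<partial>\<nu>)"
proof -
  have "ennreal (mix_density y) = (\<integral>\<^sup>+\<theta>. ennreal (cond_density \<theta> y) \<partial>G)"
    unfolding mix_density_def using cond_density_moments(1) cond_density_pos
    by (intro nn_integral_eq_integral [symmetric]) (simp_all add: less_imp_le)
  also have "\<dots> = (\<integral>\<^sup>+x. \<integral>\<^sup>+\<theta>. ennreal (normal_density (\<theta> \<bullet> x) (sqrt t) y) \<partial>G \<partial>\<nu>)"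
    unfolding ennreal_cond_density by (rule G\<nu>.Fubini' [symmetric]) measurable
  also have "\<dots> = (\<integral>\<^sup>+x. ennreal (normal_density 0 (sqrt (proj_var x)) y) \<partial>\<nu>)"
    using s t by (simp add: nn_integral_gaussian_vector_normal_density proj_var_def)
  finally show ?thesis .
qed

lemma normal_density_proj_var_bounds:
  "0 < normal_density 0 (sqrt (proj_var x)) y" "normal_density 0 (sqrt (proj_var x)) y \<le> 1 / sqrt (2 * pi * t)"
  using proj_var_pos proj_var_ge t by (auto intro: normal_density_pos normal_density_le)

lemma mix_density_eq: "mix_density y = (\<integral>x. normal_density 0 (sqrt (proj_var x)) y \<partial>\<nu>)"
proof -
  have int: "integrable \<nu> (\<lambda>x. normal_density 0 (sqrt (proj_var x)) y)"
    by (rule integrable_bounded_positive(1)[OF _ normal_density_proj_var_bounds]) measurable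
  have "ennreal (mix_density y) = ennreal (\<integral>x. normal_density 0 (sqrt (proj_var x)) y \<partial>\<nu>)"
    unfolding ennreal_mix_density using int by (intro nn_integral_eq_integral) auto
  moreover have "0 \<le> mix_density y"
    unfolding mix_density_def using cond_density_pos by (intro integral_nonneg_AE) (auto intro: less_imp_le)
  ultimately show ?thesis by simp
qed

text \<open>A squared mean is a mean over two independent copies. Their covariance is
  \<open>0\<close> because each copy is averaged over its own \<open>\<theta>\<close>.\<close>

lemma ennreal_mix_density_square:
  "ennreal ((mix_density y)\<^sup>2) = (\<integral>\<^sup>+z. ennreal (binormal_density (proj_var (fst z)) (proj_var (snd z)) 0 y y) \<partial>(\<nu> \<Otimes>\<^sub>M \<nu>))"
proof -
  let ?f = "\<lambda>x. ennreal (normal_density 0 (sqrt (proj_var x)) y)"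
  have "(\<integral>\<^sup>+z. ennreal (binormal_density (proj_var (fst z)) (proj_var (snd z)) 0 y y) \<partial>(\<nu> \<Otimes>\<^sub>M \<nu>))
    = (\<integral>\<^sup>+x. \<integral>\<^sup>+x'. ?f x * ?f x' \<partial>\<nu> \<partial>\<nu>)"
    by (subst nn_integral_fst [symmetric])
       (simp_all add: binormal_density_independent proj_var_pos ennreal_mult)
  also have "\<dots> = ennreal (mix_density y) * ennreal (mix_density y)"
    unfolding ennreal_mix_density by (simp add: nn_integral_cmult nn_integral_multc)
  finally show ?thesis
    using cond_density_moments(3)[of y] by (simp add: power2_eq_square ennreal_mult mix_density_def)
qed

text \<open>Here the two copies share one \<open>\<theta>\<close>, and averaging over it leaves a
  covariance. This is the only difference from the squared mean.\<close>

lemma ennreal_second_moment: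
  "ennreal (second_moment y) = (\<integral>\<^sup>+z. ennreal (binormal_density (proj_var (fst z)) (proj_var (snd z))
      (s * (fst z \<bullet> snd z)) y y) \<partial>(\<nu> \<Otimes>\<^sub>M \<nu>))"
proof -
  let ?f = "\<lambda>\<theta> x. ennreal (normal_density (\<theta> \<bullet> x) (sqrt t) y)"
  have sq: "ennreal ((cond_density \<theta> y)\<^sup>2) = (\<integral>\<^sup>+z. ?f \<theta> (fst z) * ?f \<theta> (snd z) \<partial>(\<nu> \<Otimes>\<^sub>M \<nu>))" for \<theta>
  proof -
    have "(\<integral>\<^sup>+z. ?f \<theta> (fst z) * ?f \<theta> (snd z) \<partial>(\<nu> \<Otimes>\<^sub>M \<nu>)) = (\<integral>\<^sup>+x. \<integral>\<^sup>+x'. ?f \<theta> x * ?f \<theta> x' \<partial>\<nu> \<partial>\<nu>)"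
      by (subst nn_integral_fst [symmetric]) simp_all
    also have "\<dots> = ennreal (cond_density \<theta> y) * ennreal (cond_density \<theta> y)"
      unfolding ennreal_cond_density by (simp add: nn_integral_cmult nn_integral_multc)
    finally show ?thesis
      using cond_density_pos[of \<theta> y] by (simp add: power2_eq_square ennreal_mult)
  qed
  have "ennreal (second_moment y) = (\<integral>\<^sup>+\<theta>. ennreal ((cond_density \<theta> y)\<^sup>2) \<partial>G)"
    unfolding second_moment_def using cond_density_moments(2)
    by (intro nn_integral_eq_integral [symmetric]) auto
  also have "\<dots> = (\<integral>\<^sup>+z. \<integral>\<^sup>+\<theta>. ?f \<theta> (fst z) * ?f \<theta> (snd z) \<partial>G \<partial>(\<nu> \<Otimes>\<^sub>M \<nu>))"
    unfolding sq by (rule G\<nu>\<nu>.Fubini' [symmetric]) measurable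
  also have "\<dots> = (\<integral>\<^sup>+z. ennreal (binormal_density (proj_var (fst z)) (proj_var (snd z))
      (s * (fst z \<bullet> snd z)) y y) \<partial>(\<nu> \<Otimes>\<^sub>M \<nu>))"
    using s t by (simp add: nn_integral_gaussian_vector_binormal_density proj_var_def)
  finally show ?thesis .
qed

section \<open>The integrated variance of the conditional density\<close>

definition mean_abs_inner :: real where
  "mean_abs_inner = (\<integral>z. \<bar>fst z \<bullet> snd z\<bar> \<partial>(\<nu> \<Otimes>\<^sub>M \<nu>))"

definition fluctuation :: "real \<Rightarrow> real" where
  "fluctuation y = second_moment y - (mix_density y)\<^sup>2"

lemma fluctuation_nonneg: "0 \<le> fluctuation y"
  using cond_density_moments(4)[of y] by (simp add: fluctuation_def second_moment_def mix_density_def)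

lemma integrable_pair_norm2: "integrable (\<nu> \<Otimes>\<^sub>M \<nu>) (\<lambda>z. (norm (fst z))\<^sup>2 + (norm (snd z))\<^sup>2)"
proof (rule integrableI_nonneg)
  have fin: "(\<integral>\<^sup>+x. ennreal ((norm x)\<^sup>2) \<partial>\<nu>) < \<infinity>"
    using integrable_norm2 by (simp add: integrable_iff_bounded)
  have "(\<integral>\<^sup>+z. ennreal ((norm (fst z))\<^sup>2 + (norm (snd z))\<^sup>2) \<partial>(\<nu> \<Otimes>\<^sub>M \<nu>))
     = (\<integral>\<^sup>+x. \<integral>\<^sup>+x'. ennreal ((norm x)\<^sup>2) + ennreal ((norm x')\<^sup>2) \<partial>\<nu> \<partial>\<nu>)"
    by (subst nn_integral_fst [symmetric]) simp_all
  also have "\<dots> = (\<integral>\<^sup>+x. ennreal ((norm x)\<^sup>2) \<partial>\<nu>) + (\<integral>\<^sup>+x. ennreal ((norm x)\<^sup>2) \<partial>\<nu>)"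
    by (simp add: nn_integral_add emeasure_space_1)
  also have "\<dots> < \<infinity>" using fin by simp
  finally show "(\<integral>\<^sup>+z. ennreal ((norm (fst z))\<^sup>2 + (norm (snd z))\<^sup>2) \<partial>(\<nu> \<Otimes>\<^sub>M \<nu>)) < \<infinity>" .
qed simp_all

lemma integrable_abs_inner: "integrable (\<nu> \<Otimes>\<^sub>M \<nu>) (\<lambda>z. \<bar>fst z \<bullet> snd z\<bar>)"
proof (rule Bochner_Integration.integrable_bound[OF integrable_pair_norm2])
  have "\<bar>x \<bullet> x'\<bar> \<le> (norm x)\<^sup>2 + (norm x')\<^sup>2" for x x' :: "real ^ 'n"
  proof -
    have "2 * (norm x * norm x') \<le> (norm x)\<^sup>2 + (norm x')\<^sup>2"
      using sum_squares_bound[of "norm x" "norm x'"] by simp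
    then show ?thesis
      using Cauchy_Schwarz_ineq2[of x x'] mult_nonneg_nonneg[of "norm x" "norm x'"] by simp
  qed
  then show "AE z in \<nu> \<Otimes>\<^sub>M \<nu>. norm \<bar>fst z \<bullet> snd z\<bar> \<le> norm ((norm (fst z))\<^sup>2 + (norm (snd z))\<^sup>2)"
    by simp
qed measurable

text \<open>Both moments are integrals over pairs, so the weighted integral over \<open>y\<close> is
  computed pair by pair, and \<open>weighted_binormal_diagonal_le\<close>, used with
  \<open>2 * t\<close>, compares the actual covariance with \<open>0\<close>.\<close>

lemma weighted_fluctuation_le:
  "(\<integral>\<^sup>+y. ennreal (1 + y\<^sup>2 / (2 * t)) * ennreal (fluctuation y) \<partial>lborel)
    \<le> ennreal (2 * (s * mean_abs_inner) / (2 * t * sqrt (2 * pi * (2 * t))))"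
proof -
  let ?w = "\<lambda>y. ennreal (1 + y\<^sup>2 / (2 * t))"
  let ?a = "\<lambda>z. proj_var (fst z)" and ?b = "\<lambda>z. proj_var (snd z)" and ?c = "\<lambda>z. s * (fst z \<bullet> snd z)"
  \<comment> \<open>\<open>F z c\<close> is the weighted diagonal integral for the pair
    \<open>z\<close> when the covariance is \<open>c\<close>.\<close>
  define F where "F z c = (1 + (?a z * ?b z - c\<^sup>2) / (?a z + ?b z - 2 * c) / (2 * t)) / sqrt (2 * pi * (?a z + ?b z - 2 * c))"
    for z and c :: real
  define k where "k = 2 / (2 * t * sqrt (2 * pi * (2 * t)))"
  have k: "0 \<le> k" using t by (simp add: k_def)
  have det: "(?c z)\<^sup>2 < ?a z * ?b z" for z
    using nn_integral_PiM_gaussian_binormal_density(1)[where I = UNIV and t = t and s = s and p = "($) (fst z)" and q = "($) (snd z)"] s t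
    by (simp add: proj_var_def inner_vec_def power2_norm_vec)
  \<comment> \<open>The right side is the variance of the difference of two observations with the
    same \<open>\<theta>\<close> and independent noises; the noises alone contribute
    \<open>2 * t\<close>.\<close>
  have D: "2 * t \<le> ?a z + ?b z - 2 * ?c z" for z
  proof -
    have "?a z + ?b z - 2 * ?c z = 2 * t + s * (norm (fst z - snd z))\<^sup>2"
      by (simp add: proj_var_def power2_norm_eq_inner inner_diff inner_commute algebra_simps)
    then show ?thesis using s by simp
  qed
  have D0: "2 * t \<le> ?a z + ?b z" for z
    using proj_var_ge[of "fst z"] proj_var_ge[of "snd z"] by simp
  have F: "F z (?c z) \<le> F z 0 + k * \<bar>?c z\<bar>" for z
    using weighted_binormal_diagonal_le[of "2 * t" "?a z" "?b z" "?c z"] t proj_var_pos det D D0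
    by (simp add: F_def k_def)
  have w_int: "(\<integral>\<^sup>+y. ?w y * (\<integral>\<^sup>+z. ennreal (binormal_density (?a z) (?b z) (g z) y y) \<partial>(\<nu> \<Otimes>\<^sub>M \<nu>)) \<partial>lborel)
      = (\<integral>\<^sup>+z. ennreal (F z (g z)) \<partial>(\<nu> \<Otimes>\<^sub>M \<nu>))"
    if [measurable]: "g \<in> borel_measurable (\<nu> \<Otimes>\<^sub>M \<nu>)"
      and g: "\<And>z. (g z)\<^sup>2 < ?a z * ?b z" "\<And>z. 2 * t \<le> ?a z + ?b z - 2 * g z" for g
  proof -
    have "(\<integral>\<^sup>+y. ?w y * (\<integral>\<^sup>+z. ennreal (binormal_density (?a z) (?b z) (g z) y y) \<partial>(\<nu> \<Otimes>\<^sub>M \<nu>)) \<partial>lborel)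
       = (\<integral>\<^sup>+y. \<integral>\<^sup>+z. ?w y * ennreal (binormal_density (?a z) (?b z) (g z) y y) \<partial>(\<nu> \<Otimes>\<^sub>M \<nu>) \<partial>lborel)"
      by (intro nn_integral_cong nn_integral_cmult [symmetric]) measurable
    also have "\<dots> = (\<integral>\<^sup>+z. \<integral>\<^sup>+y. ?w y * ennreal (binormal_density (?a z) (?b z) (g z) y y) \<partial>lborel \<partial>(\<nu> \<Otimes>\<^sub>M \<nu>))"
      by (rule \<nu>\<nu>L.Fubini') measurable
    also have "\<dots> = (\<integral>\<^sup>+z. ennreal (F z (g z)) \<partial>(\<nu> \<Otimes>\<^sub>M \<nu>))"
    proof (intro nn_integral_cong)
      fix z
      show "(\<integral>\<^sup>+y. ?w y * ennreal (binormal_density (?a z) (?b z) (g z) y y) \<partial>lborel) = ennreal (F z (g z))"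
        unfolding F_def using g[of z] t by (intro nn_integral_weighted_binormal_diagonal) auto
    qed
    finally show ?thesis .
  qed
  have mix: "(\<integral>\<^sup>+y. ?w y * ennreal ((mix_density y)\<^sup>2) \<partial>lborel) = (\<integral>\<^sup>+z. ennreal (F z 0) \<partial>(\<nu> \<Otimes>\<^sub>M \<nu>))"
    unfolding ennreal_mix_density_square using D0 proj_var_pos by (subst w_int) auto
  have second: "(\<integral>\<^sup>+y. ?w y * ennreal (second_moment y) \<partial>lborel) = (\<integral>\<^sup>+z. ennreal (F z (?c z)) \<partial>(\<nu> \<Otimes>\<^sub>M \<nu>))"
    unfolding ennreal_second_moment using det D by (subst w_int) auto
  have F0: "0 \<le> F z 0" for z
    using D0[of z] t proj_var_pos[of "fst z"] proj_var_pos[of "snd z"] by (simp add: F_def)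
  have [measurable]: "(\<lambda>z. F z 0) \<in> borel_measurable (\<nu> \<Otimes>\<^sub>M \<nu>)"
    unfolding F_def by measurable
  \<comment> \<open>Finiteness allows this integral to be cancelled at the end. It comes from
    \<open>a * b / (a + b) \<le> a + b\<close> for positive \<open>a\<close>, \<open>b\<close> and
    from the second moment of \<open>\<nu>\<close>.\<close>
  have finite: "(\<integral>\<^sup>+z. ennreal (F z 0) \<partial>(\<nu> \<Otimes>\<^sub>M \<nu>)) < \<infinity>"
  proof -
    define C where "C = 1 / sqrt (2 * pi * (2 * t))"
    have C: "0 \<le> C" using t by (simp add: C_def)
    have bound: "F z 0 \<le> (1 + (2 * t + s * ((norm (fst z))\<^sup>2 + (norm (snd z))\<^sup>2)) / (2 * t)) * C" for z
    proof -
      have pos: "0 < ?a z" "0 < ?b z" by (simp_all add: proj_var_pos)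
      have "?a z * ?b z \<le> (?a z + ?b z) * (?a z + ?b z)"
        using pos by (intro mult_mono) auto
      then have "?a z * ?b z / (?a z + ?b z) \<le> ?a z + ?b z"
        using pos by (simp add: pos_divide_le_eq)
      then have "F z 0 \<le> (1 + (?a z + ?b z) / (2 * t)) / sqrt (2 * pi * (2 * t))"
        unfolding F_def using t pos D0[of z] by (intro frac_le add_mono divide_right_mono) auto
      moreover have "?a z + ?b z = 2 * t + s * ((norm (fst z))\<^sup>2 + (norm (snd z))\<^sup>2)"
        by (simp add: proj_var_def algebra_simps)
      ultimately show ?thesis by (simp only: C_def) simp
    qed
    have "integrable (\<nu> \<Otimes>\<^sub>M \<nu>) (\<lambda>z. (1 + (2 * t + s * ((norm (fst z))\<^sup>2 + (norm (snd z))\<^sup>2)) / (2 * t)) * C)"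
      by (intro integrable_mult_left Bochner_Integration.integrable_add integrable_divide integrable_mult_right
          integrable_pair_norm2) auto
    then have "integrable (\<nu> \<Otimes>\<^sub>M \<nu>) (\<lambda>z. F z 0)"
      by (rule Bochner_Integration.integrable_bound) (use bound F0 in \<open>auto intro!: AE_I2 order_trans[OF _ abs_ge_self]\<close>)
    then show ?thesis
      using F0 by (simp add: integrable_iff_bounded)
  qed
  \<comment> \<open>Subtraction of extended nonnegative numbers is avoided: the sum is estimated and
    its finite summand cancelled.\<close>
  have "(\<integral>\<^sup>+y. ?w y * ennreal ((mix_density y)\<^sup>2) \<partial>lborel) + (\<integral>\<^sup>+y. ?w y * ennreal (fluctuation y) \<partial>lborel)
     = (\<integral>\<^sup>+y. ?w y * ennreal (second_moment y) \<partial>lborel)"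
  proof -
    have "ennreal (second_moment y) = ennreal ((mix_density y)\<^sup>2) + ennreal (fluctuation y)" for y
      using fluctuation_nonneg[of y] by (subst ennreal_plus [symmetric]) (auto simp: fluctuation_def)
    then show ?thesis
      unfolding fluctuation_def
      by (subst nn_integral_add [symmetric]) (auto simp: distrib_left fluctuation_def)
  qed
  also have "\<dots> \<le> (\<integral>\<^sup>+z. ennreal (F z 0) + ennreal (k * \<bar>?c z\<bar>) \<partial>(\<nu> \<Otimes>\<^sub>M \<nu>))"
    unfolding second using F F0 k
    by (intro nn_integral_mono) (simp add: ennreal_plus [symmetric] ennreal_leI del: ennreal_plus)
  also have "\<dots> = (\<integral>\<^sup>+z. ennreal (F z 0) \<partial>(\<nu> \<Otimes>\<^sub>M \<nu>)) + (\<integral>\<^sup>+z. ennreal (k * \<bar>?c z\<bar>) \<partial>(\<nu> \<Otimes>\<^sub>M \<nu>))"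
    by (rule nn_integral_add) auto
  also have "(\<integral>\<^sup>+z. ennreal (k * \<bar>?c z\<bar>) \<partial>(\<nu> \<Otimes>\<^sub>M \<nu>)) = ennreal (k * (s * mean_abs_inner))"
    using integrable_abs_inner k s
    by (subst nn_integral_eq_integral) (auto simp: abs_mult mean_abs_inner_def)
  finally show ?thesis
    using less_imp_neq[OF finite] unfolding mix by (simp add: ennreal_add_left_cancel_le k_def)
qed

text \<open>On the whole line the integral of a function does not control that of its square root,
  so a weight with integrable inverse is inserted before Cauchy--Schwarz is applied.\<close>

lemma nn_integral_sqrt_fluctuation_le:
  "(\<integral>\<^sup>+y. ennreal (89 / 100 * sqrt (fluctuation y)) \<partial>lborel) \<le> ennreal (sqrt (s * mean_abs_inner / t))"
proof -
  define I where "I = s * mean_abs_inner"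
  have I: "0 \<le> I" using s by (simp add: I_def mean_abs_inner_def)
  let ?w = "\<lambda>y. 1 + y\<^sup>2 / (2 * t)"
  have w: "0 < ?w y" for y :: real using t by (simp add: add_pos_nonneg)
  have [measurable]: "fluctuation \<in> borel_measurable borel"
    unfolding fluctuation_def by measurable
  have split: "ennreal (sqrt (fluctuation y)) = ennreal (sqrt (?w y * fluctuation y)) * ennreal (sqrt (1 / ?w y))" for y
  proof -
    have "sqrt (fluctuation y) = sqrt (?w y * fluctuation y) * sqrt (1 / ?w y)"
      unfolding real_sqrt_mult [symmetric] using w[of y] by simp
    moreover have "0 \<le> sqrt (1 / ?w y)"
      using w[of y] by (intro real_sqrt_ge_zero) simp
    ultimately show ?thesis by (simp only: ennreal_mult'')
  qed
  have "(\<integral>\<^sup>+y. ennreal (sqrt (fluctuation y)) \<partial>lborel)\<^sup>2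
    = (\<integral>\<^sup>+y. ennreal (sqrt (?w y * fluctuation y)) * ennreal (sqrt (1 / ?w y)) \<partial>lborel)\<^sup>2"
    unfolding split ..
  also have "\<dots> \<le> (\<integral>\<^sup>+y. (ennreal (sqrt (?w y * fluctuation y)))\<^sup>2 \<partial>lborel) * (\<integral>\<^sup>+y. (ennreal (sqrt (1 / ?w y)))\<^sup>2 \<partial>lborel)"
    by (rule Cauchy_Schwarz_nn_integral) measurable
  also have "\<dots> = (\<integral>\<^sup>+y. ennreal (?w y) * ennreal (fluctuation y) \<partial>lborel) * (\<integral>\<^sup>+y. ennreal (1 / ?w y) \<partial>lborel)"
    using w fluctuation_nonneg
    by (simp add: ennreal_power less_imp_le ennreal_mult)
  also have "\<dots> \<le> ennreal (2 * I / (2 * t * sqrt (2 * pi * (2 * t)))) * ennreal (pi * sqrt (2 * t))"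
    using weighted_fluctuation_le nn_integral_inverse_weight[of "2 * t"] t
    by (intro mult_mono) (auto simp: I_def)
  also have "\<dots> = ennreal (sqrt (pi / 2) * (I / t))"
  proof -
    \<comment> \<open>Writing \<open>pi\<close> as \<open>2 * r * r\<close> and the root in the
      denominator as \<open>2 * r * q\<close> turns the identity into a rational one.\<close>
    define r q where "r = sqrt (pi / 2)" and "q = sqrt (2 * t)"
    have rq: "0 < r" "0 < q" using t by (simp_all add: r_def q_def)
    have "r * r = pi / 2" by (simp add: r_def)
    then have pi: "pi = 2 * r * r" by simp
    have "sqrt (2 * pi * (2 * t)) = sqrt (4 * (pi / 2) * (2 * t))" by simp
    also have "\<dots> = 2 * r * q" by (simp only: real_sqrt_mult real_sqrt_four r_def q_def)
    finally have root: "sqrt (2 * pi * (2 * t)) = 2 * r * q" .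
    have "2 * I / (2 * t * (2 * r * q)) * (2 * r * r * q) = r * (I / t)"
      using rq t by (simp add: field_simps)
    then have "2 * I / (2 * t * sqrt (2 * pi * (2 * t))) * (pi * sqrt (2 * t)) = sqrt (pi / 2) * (I / t)"
      unfolding root q_def [symmetric] r_def [symmetric] pi [symmetric] by simp
    then show ?thesis using t I by (simp add: ennreal_mult [symmetric])
  qed
  finally have sq: "(\<integral>\<^sup>+y. ennreal (sqrt (fluctuation y)) \<partial>lborel)\<^sup>2 \<le> ennreal (sqrt (pi / 2) * (I / t))" .
  have "(\<integral>\<^sup>+y. ennreal (89 / 100 * sqrt (fluctuation y)) \<partial>lborel)
     = ennreal (89 / 100) * (\<integral>\<^sup>+y. ennreal (sqrt (fluctuation y)) \<partial>lborel)"
  proof -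
    have "ennreal (89 / 100 * sqrt (fluctuation y)) = ennreal (89 / 100) * ennreal (sqrt (fluctuation y))" for y
      using fluctuation_nonneg[of y] by (intro ennreal_mult) auto
    then show ?thesis by (simp only:) (rule nn_integral_cmult, measurable)
  qed
  then have "(\<integral>\<^sup>+y. ennreal (89 / 100 * sqrt (fluctuation y)) \<partial>lborel)\<^sup>2
     \<le> (ennreal (89 / 100))\<^sup>2 * ennreal (sqrt (pi / 2) * (I / t))"
    using sq by (simp only: power_mult_distrib mult_left_mono) (simp add: mult_left_mono)
  also have "\<dots> = ennreal ((89 / 100)\<^sup>2 * sqrt (pi / 2) * (I / t))"
    using I t by (simp only: ennreal_power) (simp add: ennreal_mult [symmetric] mult.assoc)
  also have "\<dots> \<le> ennreal (1 * (I / t))"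
  proof (intro ennreal_leI mult_right_mono)
    \<comment> \<open>The root is about 1.2533; the bound is tight enough for
      \<open>(89 / 100)\<^sup>2 * (126 / 100)\<close> to stay below \<open>1\<close>.\<close>
    have "sqrt (pi / 2) \<le> 126 / 100"
      using pi_approx by (intro real_le_lsqrt) (auto simp: power2_eq_square)
    then show "(89 / 100)\<^sup>2 * sqrt (pi / 2) \<le> 1"
      by (simp add: power2_eq_square)
  qed (use I t in auto)
  also have "\<dots> = (ennreal (sqrt (I / t)))\<^sup>2"
    using I t by (simp add: ennreal_power)
  finally show ?thesis
    unfolding I_def by (rule ennreal_le_if_square_le) (use I t in \<open>simp add: I_def\<close>)
qed

text \<open>The integrals are exchanged so that the moment bound applies at each fixed
  \<open>y\<close> with \<open>\<theta>\<close> random. After Jensen's inequality a second exchange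
  produces, for each \<open>x\<close>, a divergence between two centered normal laws.\<close>

lemma cond_density_kl_le:
  assumes "t \<le> T"
  shows "(\<integral>\<^sup>+\<theta>. \<integral>\<^sup>+y. ennreal (kl_term (cond_density \<theta> y) (normal_density 0 (sqrt T) y)) \<partial>lborel \<partial>G)
    \<le> ennreal ((\<integral>x. \<bar>proj_var x - T\<bar> \<partial>\<nu>) / (2 * t) + sqrt (s * mean_abs_inner / t))"
proof -
  let ?q = "normal_density 0 (sqrt T)"
  have q: "0 < ?q y" for y using assms t by (intro normal_density_pos) auto
  have [measurable]: "fluctuation \<in> borel_measurable borel"
    unfolding fluctuation_def by measurable
  have "(\<integral>\<^sup>+\<theta>. \<integral>\<^sup>+y. ennreal (kl_term (cond_density \<theta> y) (?q y)) \<partial>lborel \<partial>G)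
     = (\<integral>\<^sup>+y. \<integral>\<^sup>+\<theta>. ennreal (kl_term (cond_density \<theta> y) (?q y)) \<partial>G \<partial>lborel)"
    by (rule GL.Fubini' [symmetric]) measurable
  also have "\<dots> \<le> (\<integral>\<^sup>+y. ennreal (89 / 100 * sqrt (fluctuation y))
       + (\<integral>\<^sup>+x. ennreal (kl_term (normal_density 0 (sqrt (proj_var x)) y) (?q y)) \<partial>\<nu>) \<partial>lborel)"
  proof (intro nn_integral_mono)
    fix y
    have "(\<integral>\<^sup>+\<theta>. ennreal (kl_term (cond_density \<theta> y) (?q y)) \<partial>G)
      \<le> ennreal (89 / 100 * sqrt (fluctuation y)) + ennreal (kl_term (mix_density y) (?q y))"
      unfolding fluctuation_def second_moment_def mix_density_def
      by (rule G.nn_integral_kl_term_le[OF _ cond_density_pos cond_density_le q]) measurable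
    also have "ennreal (kl_term (mix_density y) (?q y))
       \<le> (\<integral>\<^sup>+x. ennreal (kl_term (normal_density 0 (sqrt (proj_var x)) y) (?q y)) \<partial>\<nu>)"
      unfolding mix_density_eq
      by (rule kl_term_expectation_le[OF _ normal_density_proj_var_bounds q]) measurable
    finally show "(\<integral>\<^sup>+\<theta>. ennreal (kl_term (cond_density \<theta> y) (?q y)) \<partial>G)
      \<le> ennreal (89 / 100 * sqrt (fluctuation y))
        + (\<integral>\<^sup>+x. ennreal (kl_term (normal_density 0 (sqrt (proj_var x)) y) (?q y)) \<partial>\<nu>)"
      by (simp add: add_left_mono)
  qed
  also have "\<dots> = (\<integral>\<^sup>+y. ennreal (89 / 100 * sqrt (fluctuation y)) \<partial>lborel)
       + (\<integral>\<^sup>+y. \<integral>\<^sup>+x. ennreal (kl_term (normal_density 0 (sqrt (proj_var x)) y) (?q y)) \<partial>\<nu> \<partial>lborel)"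
    by (rule nn_integral_add) measurable
  also have "(\<integral>\<^sup>+y. \<integral>\<^sup>+x. ennreal (kl_term (normal_density 0 (sqrt (proj_var x)) y) (?q y)) \<partial>\<nu> \<partial>lborel)
     = (\<integral>\<^sup>+x. \<integral>\<^sup>+y. ennreal (kl_term (normal_density 0 (sqrt (proj_var x)) y) (?q y)) \<partial>lborel \<partial>\<nu>)"
    by (rule \<nu>L.Fubini') measurable
  also have "\<dots> \<le> (\<integral>\<^sup>+x. ennreal (\<bar>proj_var x - T\<bar> / (2 * t)) \<partial>\<nu>)"
    using t assms proj_var_ge by (intro nn_integral_mono nn_integral_kl_term_normal_le) auto
  also have "\<dots> = ennreal ((\<integral>x. \<bar>proj_var x - T\<bar> \<partial>\<nu>) / (2 * t))"
  proof -
    have "integrable \<nu> (\<lambda>x. \<bar>proj_var x - T\<bar>)"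
      unfolding proj_var_def using integrable_norm2 by auto
    then show ?thesis using t by (subst nn_integral_eq_integral) auto
  qed
  finally show ?thesis
    using nn_integral_sqrt_fluctuation_le t s
    by (subst add.commute, subst ennreal_plus) (auto intro: add_mono order_trans simp: mean_abs_inner_def)
qed

end

subsection \<open>Conditional laws and independence\<close>

text \<open>For each endpoint the measures of the half-line agree outside a null set. Rational
  endpoints leave a single null set, and right continuity of the distribution functions recovers all
  others.\<close>

lemma AE_eq_if_AE_eq_atMost:
  fixes K L :: "'c \<Rightarrow> real measure"
  assumes "sigma_finite_measure \<mu>"
    and K: "\<And>z. z \<in> space \<mu> \<Longrightarrow> real_distribution (K z)" and L: "\<And>z. z \<in> space \<mu> \<Longrightarrow> real_distribution (L z)"
    and [measurable]: "\<And>a. (\<lambda>z. emeasure (K z) {..a}) \<in> borel_measurable \<mu>" "\<And>a. (\<lambda>z. emeasure (L z) {..a}) \<in> borel_measurable \<mu>"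
    and eq: "\<And>A a. A \<in> sets \<mu> \<Longrightarrow> (\<integral>\<^sup>+z. emeasure (K z) {..a} * indicator A z \<partial>\<mu>) = (\<integral>\<^sup>+z. emeasure (L z) {..a} * indicator A z \<partial>\<mu>)"
  shows "AE z in \<mu>. K z = L z"
proof -
  interpret sigma_finite_measure \<mu> by fact
  have "AE z in \<mu>. emeasure (K z) {..a} = emeasure (L z) {..a}" for a
    using eq by (intro density_unique2) auto
  then have "AE z in \<mu>. \<forall>a\<in>\<rat>. emeasure (K z) {..a} = emeasure (L z) {..a}"
    by (simp add: AE_ball_countable countable_rat)
  with AE_space show ?thesis
  proof eventually_elim
    case (elim z)
    interpret K: real_distribution "K z" using K elim by simp
    interpret L: real_distribution "L z" using L elim by simp
    have rat: "cdf (K z) q = cdf (L z) q" if "q \<in> \<rat>" for q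
      using elim(2) that by (simp add: cdf_def measure_def)
    \<comment> \<open>Stated for arbitrary measures because it is used in both orders, to exclude
      either strict inequality.\<close>
    have less: False if M: "real_distribution M" "real_distribution M'"
      and rat: "\<And>q. q \<in> \<rat> \<Longrightarrow> cdf M q = cdf M' q" and lt: "cdf M a < cdf M' a" for M M' a
    proof -
      interpret M: real_distribution M by fact
      interpret M': real_distribution M' by fact
      \<comment> \<open>The strict inequality persists slightly to the right of \<open>a\<close>,
        hence at a rational point, where the agreement with the nondecreasing \<open>cdf M'\<close>
        contradicts it.\<close>
      have "eventually (\<lambda>x. cdf M x < cdf M' a) (at_right a)"
        using M.cdf_is_right_cont lt unfolding continuous_within by (rule order_tendstoD)
      then obtain b where b: "a < b" "\<And>x. a < x \<Longrightarrow> x < b \<Longrightarrow> cdf M x < cdf M' a"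
        unfolding eventually_at_right_field by auto
      obtain q where q: "q \<in> \<rat>" "a < q" "q < b" using Rats_dense_in_real[OF b(1)] by auto
      have "cdf M' a \<le> cdf M' q" using q by (intro M'.cdf_nondecreasing) simp
      with rat[OF q(1)] b(2)[OF q(2,3)] show False by simp
    qed
    have "cdf (K z) = cdf (L z)"
    proof
      fix a
      show "cdf (K z) a = cdf (L z) a"
        using less[of "K z" "L z" a] less[of "L z" "K z" a] rat K.real_distribution_axioms L.real_distribution_axioms
        by (metis linorder_less_linear)
    qed
    then show "K z = L z"
      by (intro cdf_unique K.real_distribution_axioms L.real_distribution_axioms)
  qed
qed

text \<open>The middle variable is placed first since it is \<open>\<Theta>\<close> in the
  application, over which the outermost integral is taken. Uniqueness of product measures is used
  once for each of the two nested products.\<close>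

lemma (in prob_space) indep_vars3_distr:
  assumes "indep_vars3 M X Y Z"
  shows "distr M (borel \<Otimes>\<^sub>M (borel \<Otimes>\<^sub>M borel)) (\<lambda>\<omega>. (Y \<omega>, X \<omega>, Z \<omega>))
    = distr M borel Y \<Otimes>\<^sub>M (distr M borel X \<Otimes>\<^sub>M distr M borel Z)"
proof -
  have [measurable]: "X \<in> borel_measurable M" "Y \<in> borel_measurable M" "Z \<in> borel_measurable M"
    using assms by (auto simp: indep_vars3_def)
  interpret X: prob_space "distr M borel X" by (rule prob_space_distr) measurable
  interpret Y: prob_space "distr M borel Y" by (rule prob_space_distr) measurable
  interpret Z: prob_space "distr M borel Z" by (rule prob_space_distr) measurable
  interpret XZ: pair_prob_space "distr M borel X" "distr M borel Z" ..
  have indep: "emeasure M (Y -` B \<inter> (X -` A \<inter> Z -` C) \<inter> space M)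
     = emeasure (distr M borel Y) B * (emeasure (distr M borel X) A * emeasure (distr M borel Z) C)"
    if [measurable]: "A \<in> sets borel" "B \<in> sets borel" "C \<in> sets borel" for A B C
  proof -
    let ?E = "\<lambda>j::nat. if j = 0 then X -` A \<inter> space M else if j = 1 then Y -` B \<inter> space M else Z -` C \<inter> space M"
    have "prob (\<Inter>j\<in>{0,1,2}. ?E j) = (\<Prod>j\<in>{0,1,2}. prob (?E j))"
    proof (rule indep_setsD)
      have "X -` A \<inter> space M \<in> {X -` A \<inter> space M | A. A \<in> sets borel}"
        "Y -` B \<inter> space M \<in> {Y -` A \<inter> space M | A. A \<in> sets borel}"
        "Z -` C \<inter> space M \<in> {Z -` A \<inter> space M | A. A \<in> sets borel}"
        using that by blast+
      then show "\<forall>j\<in>{0, 1, 2}. ?E j \<in> (if j = 0 then {X -` A \<inter> space M | A. A \<in> sets borel}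
           else if j = 1 then {Y -` A \<inter> space M | A. A \<in> sets borel}
           else {Z -` A \<inter> space M | A. A \<in> sets borel})"
        by simp
    qed (use assms in \<open>auto simp: indep_vars3_def\<close>)
    moreover have "(\<Inter>j\<in>{0,1,2}. ?E j) = Y -` B \<inter> (X -` A \<inter> Z -` C) \<inter> space M" by auto
    ultimately show ?thesis
      by (simp add: emeasure_distr emeasure_eq_measure ennreal_mult [symmetric] mult_ac)
  qed
  show ?thesis
  proof (rule pair_measure_eqI [symmetric])
    fix B S assume B: "B \<in> sets (distr M borel Y)" and S: "S \<in> sets (distr M borel X \<Otimes>\<^sub>M distr M borel Z)"
    then have [measurable]: "B \<in> sets borel" "S \<in> sets (borel \<Otimes>\<^sub>M borel)"
      by (simp_all cong: sets_pair_measure_cong)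
    define c where "c = emeasure (distr M borel Y) B"
    have c: "c \<le> 1" by (simp add: c_def Y.emeasure_le_1)
    \<comment> \<open>The law of \<open>(X, Z)\<close> restricted to the event that \<open>Y\<close>
      lies in \<open>B\<close>.\<close>
    define D where "D = distr (density M (indicator (Y -` B \<inter> space M))) (borel \<Otimes>\<^sub>M borel) (\<lambda>\<omega>. (X \<omega>, Z \<omega>))"
    interpret cX: finite_measure "density (distr M borel X) (\<lambda>_. c)"
      using c by (intro finite_measureI)
        (auto simp: emeasure_density X.emeasure_space_1[simplified] nn_integral_cmult top_unique)
    \<comment> \<open>For fixed \<open>B\<close>, both sides are finite measures in \<open>S\<close> that agree on rectangles.\<close>
    have "density (distr M borel X) (\<lambda>_. c) \<Otimes>\<^sub>M distr M borel Z = D"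
    proof (rule pair_measure_eqI)
      fix A C assume "A \<in> sets (density (distr M borel X) (\<lambda>_. c))" "C \<in> sets (distr M borel Z)"
      then have [measurable]: "A \<in> sets borel" "C \<in> sets borel" by auto
      have "emeasure D (A \<times> C) = emeasure M (Y -` B \<inter> (X -` A \<inter> Z -` C) \<inter> space M)"
        unfolding D_def
        by (subst emeasure_distr, simp, simp, subst emeasure_density)
          (auto simp: indicator_inter_arith [symmetric] intro!: arg_cong[where f = "emeasure M"])
      then show "emeasure (density (distr M borel X) (\<lambda>_. c)) A * emeasure (distr M borel Z) C = emeasure D (A \<times> C)"
        by (simp add: indep emeasure_density nn_integral_cmult c_def mult.assoc)
    qed (auto simp: D_def cX.sigma_finite_measure_axioms Z.sigma_finite_measure_axioms cong: sets_pair_measure_cong)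
    then have "emeasure D S = emeasure (density (distr M borel X) (\<lambda>_. c) \<Otimes>\<^sub>M distr M borel Z) S" by simp
    also have "\<dots> = c * emeasure (distr M borel X \<Otimes>\<^sub>M distr M borel Z) S"
      by (simp add: Z.emeasure_pair_measure_alt nn_integral_density nn_integral_cmult cong: sets_pair_measure_cong)
    finally have "c * emeasure (distr M borel X \<Otimes>\<^sub>M distr M borel Z) S = emeasure D S" ..
    also have "\<dots> = emeasure (distr M (borel \<Otimes>\<^sub>M (borel \<Otimes>\<^sub>M borel)) (\<lambda>\<omega>. (Y \<omega>, X \<omega>, Z \<omega>))) (B \<times> S)"
      unfolding D_def
      by (subst emeasure_distr, simp, simp, subst emeasure_density)
        (auto simp: indicator_inter_arith [symmetric] emeasure_distr intro!: arg_cong[where f = "emeasure M"])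
    finally show "emeasure (distr M borel Y) B * emeasure (distr M borel X \<Otimes>\<^sub>M distr M borel Z) S
      = emeasure (distr M (borel \<Otimes>\<^sub>M (borel \<Otimes>\<^sub>M borel)) (\<lambda>\<omega>. (Y \<omega>, X \<omega>, Z \<omega>))) (B \<times> S)"
      unfolding c_def .
  qed (auto simp: Y.sigma_finite_measure_axioms XZ.P.sigma_finite_measure_axioms cong: sets_pair_measure_cong)
qed

lemma (in prob_space) distr_gaussian_vector:
  fixes \<Theta> :: "'a \<Rightarrow> real ^ 'n"
  assumes [measurable]: "\<Theta> \<in> borel_measurable M"
    and indep: "indep_vars (\<lambda>_. borel) (\<lambda>i \<omega>. \<Theta> \<omega> $ i) UNIV"
    and law: "\<And>i. distr M borel (\<lambda>\<omega>. \<Theta> \<omega> $ i) = gaussian 0 s"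
  shows "distr M borel \<Theta> = gaussian_vector s"
proof -
  have [measurable]: "(\<lambda>\<omega>. \<Theta> \<omega> $ i) \<in> borel_measurable M" for i
    using indep by (auto simp: indep_vars_def)
  have "distr M (\<Pi>\<^sub>M i\<in>UNIV. borel) (\<lambda>\<omega>. \<lambda>i\<in>UNIV. \<Theta> \<omega> $ i) = (\<Pi>\<^sub>M i\<in>UNIV. gaussian 0 s)"
    using indep by (subst (asm) indep_vars_iff_distr_eq_PiM') (auto simp: law)
  then have "gaussian_vector s
      = distr (distr M (\<Pi>\<^sub>M i\<in>UNIV. borel) (\<lambda>\<omega>. \<lambda>i\<in>UNIV. \<Theta> \<omega> $ i)) borel (\<lambda>f. \<chi> i. f i)"
    by (simp add: gaussian_vector_def)
  also have "\<dots> = distr M borel \<Theta>"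
  proof (subst distr_distr)
    show "(\<lambda>\<omega>. \<lambda>i\<in>UNIV. \<Theta> \<omega> $ i) \<in> M \<rightarrow>\<^sub>M (\<Pi>\<^sub>M i\<in>UNIV. borel)"
      by (rule measurable_restrict) measurable
  qed (simp_all add: comp_def restrict_def)
  finally show ?thesis ..
qed

text \<open>The substitution \<open>y = m + sqrt t * n\<close> carries the standard normal law to
  the one with mean \<open>m\<close> and variance \<open>t\<close>.\<close>

lemma nn_integral_gaussian_affine:
  assumes [measurable]: "B \<in> sets borel" and "0 < t"
  shows "(\<integral>\<^sup>+n. indicator B (m + sqrt t * n) \<partial>gaussian 0 1)
    = (\<integral>\<^sup>+y. ennreal (normal_density m (sqrt t) y) * indicator B y \<partial>lborel)"
proof -
  have "sqrt t * normal_density m (sqrt t) (m + sqrt t * n) = normal_density 0 1 n" for n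
    using assms by (simp add: normal_density_def real_sqrt_mult power_mult_distrib)
  then have "ennreal (sqrt t) * ennreal (normal_density m (sqrt t) (m + sqrt t * n)) = ennreal (normal_density 0 1 n)" for n
    by (simp add: ennreal_mult'' [symmetric])
  then show ?thesis
    unfolding gaussian_def using assms
    by (subst nn_integral_density, simp, simp, subst (2) nn_integral_real_affine[where c = "sqrt t" and t = m])
      (simp_all add: nn_integral_cmult [symmetric] mult.assoc [symmetric])
qed

section \<open>The entropy bound for the conditional law of the projection\<close>

theorem theorem10:
  fixes M :: "'a measure"
    and X \<Theta> :: "'a \<Rightarrow> real ^ 'n"
    and N Y :: "'a \<Rightarrow> real"
    and P :: "real ^ 'n \<Rightarrow> real measure"
    and t \<gamma> :: real
  assumes "prob_space M"
    and "t > 0"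
    and "\<gamma> > 0"
    and "integrable M (\<lambda>\<omega>. (norm (X \<omega>))\<^sup>2)"
    and "1 / real CARD('n) * (\<integral>\<omega>. (norm (X \<omega>))\<^sup>2 \<partial>M) = \<gamma>"
    and "prob_space.indep_vars M (\<lambda>_. borel) (\<lambda>i \<omega>. \<Theta> \<omega> $ i) UNIV"
    and "\<And>i. distr M borel (\<lambda>\<omega>. \<Theta> \<omega> $ i) = gaussian 0 (1 / real CARD('n))"
    and "distr M borel N = gaussian 0 1"
    and "indep_vars3 M X \<Theta> N"
    and "\<And>\<omega>. Y \<omega> = \<Theta> \<omega> \<bullet> X \<omega> + sqrt t * N \<omega>"
    and "cond_distribution M Y \<Theta> P"
  shows "(\<integral>\<^sup>+\<omega>. relative_entropy (P (\<Theta> \<omega>)) (gaussian 0 (\<gamma> + t)) \<partial>M)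
           \<le> ennreal (alpha M X / (2 * t) + sqrt (beta1 M X / t))"
proof -
  interpret M: prob_space M by fact
  have [measurable]: "X \<in> borel_measurable M" "\<Theta> \<in> borel_measurable M" "N \<in> borel_measurable M"
    using assms(9) by (auto simp: indep_vars3_def)
  define s where "s = 1 / real CARD('n)"
  have s: "0 < s" by (simp add: s_def)
  let ?\<nu> = "distr M borel X"
  interpret \<nu>: prob_space ?\<nu> by (rule M.prob_space_distr) measurable
  interpret gaussian_projection ?\<nu> s t
    using assms s by unfold_locales (simp_all add: integrable_distr_eq)
  have law: "distr M borel \<Theta> = G"
    by (rule M.distr_gaussian_vector) (use assms in \<open>auto simp: s_def\<close>)
  let ?q = "normal_density 0 (sqrt (\<gamma> + t))"
  have kernel: "P \<in> borel \<rightarrow>\<^sub>M prob_algebra borel"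
    and cond: "\<And>A B. A \<in> sets borel \<Longrightarrow> B \<in> sets borel \<Longrightarrow>
        emeasure M (\<Theta> -` A \<inter> Y -` B \<inter> space M) = (\<integral>\<^sup>+\<theta>. emeasure (P \<theta>) B * indicator A \<theta> \<partial>G)"
    using assms(11) by (simp_all add: cond_distribution_def law)
  have P_measurable: "(\<lambda>\<theta>. emeasure (P \<theta>) B) \<in> borel_measurable borel" if "B \<in> sets borel" for B
    using measurable_emeasure_subprob_algebra[OF that] measurable_prob_algebraD[OF kernel] by (rule measurable_compose[rotated])
  \<comment> \<open>The kernel with density \<open>cond_density \<theta>\<close> satisfies the
    identity that characterizes \<open>P\<close>. The joint law is integrated with the noise
    innermost, where the affine substitution applies.\<close>
  have joint: "emeasure M (\<Theta> -` A \<inter> Y -` B \<inter> space M)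
      = (\<integral>\<^sup>+\<theta>. emeasure (density lborel (cond_density \<theta>)) B * indicator A \<theta> \<partial>G)"
    if [measurable]: "A \<in> sets borel" "B \<in> sets borel" for A B
  proof -
    interpret \<nu>N: pair_sigma_finite ?\<nu> "gaussian 0 1"
      using prob_space_gaussian[of 1] by (intro pair_sigma_finite.intro) (auto intro: prob_space_imp_sigma_finite \<nu>.sigma_finite_measure_axioms)
    let ?f = "\<lambda>(\<theta>, x, n). indicator A \<theta> * indicator B (\<theta> \<bullet> x + sqrt t * n) :: ennreal"
    have "emeasure M (\<Theta> -` A \<inter> Y -` B \<inter> space M) = (\<integral>\<^sup>+\<omega>. ?f (\<Theta> \<omega>, X \<omega>, N \<omega>) \<partial>M)"
    proof -
      have [measurable]: "Y \<in> borel_measurable M" unfolding assms(10)[abs_def] by measurable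
      have "(\<integral>\<^sup>+\<omega>. ?f (\<Theta> \<omega>, X \<omega>, N \<omega>) \<partial>M) = (\<integral>\<^sup>+\<omega>. indicator (\<Theta> -` A \<inter> Y -` B \<inter> space M) \<omega> \<partial>M)"
        by (intro nn_integral_cong) (auto simp: assms(10) split: split_indicator)
      then show ?thesis by simp
    qed
    also have "\<dots> = (\<integral>\<^sup>+z. ?f z \<partial>distr M (borel \<Otimes>\<^sub>M (borel \<Otimes>\<^sub>M borel)) (\<lambda>\<omega>. (\<Theta> \<omega>, X \<omega>, N \<omega>)))"
      by (rule nn_integral_distr [symmetric]) measurable
    also have "distr M (borel \<Otimes>\<^sub>M (borel \<Otimes>\<^sub>M borel)) (\<lambda>\<omega>. (\<Theta> \<omega>, X \<omega>, N \<omega>)) = G \<Otimes>\<^sub>M (?\<nu> \<Otimes>\<^sub>M gaussian 0 1)"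
      using M.indep_vars3_distr[OF assms(9)] by (simp add: law assms(8))
    also have "(\<integral>\<^sup>+z. ?f z \<partial>(G \<Otimes>\<^sub>M (?\<nu> \<Otimes>\<^sub>M gaussian 0 1)))
        = (\<integral>\<^sup>+\<theta>. \<integral>\<^sup>+x. \<integral>\<^sup>+n. ?f (\<theta>, x, n) \<partial>gaussian 0 1 \<partial>?\<nu> \<partial>G)"
      by (subst \<nu>N.nn_integral_fst [symmetric]) (simp_all add: \<nu>N.M2.nn_integral_fst [symmetric])
    also have "\<dots> = (\<integral>\<^sup>+\<theta>. emeasure (density lborel (cond_density \<theta>)) B * indicator A \<theta> \<partial>G)"
    proof (intro nn_integral_cong)
      fix \<theta>
      have "(\<integral>\<^sup>+x. \<integral>\<^sup>+n. ?f (\<theta>, x, n) \<partial>gaussian 0 1 \<partial>?\<nu>)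
        = indicator A \<theta> * (\<integral>\<^sup>+x. \<integral>\<^sup>+y. ennreal (normal_density (\<theta> \<bullet> x) (sqrt t) y) * indicator B y \<partial>lborel \<partial>?\<nu>)"
        using t by (simp add: nn_integral_cmult nn_integral_gaussian_affine)
      also have "(\<integral>\<^sup>+x. \<integral>\<^sup>+y. ennreal (normal_density (\<theta> \<bullet> x) (sqrt t) y) * indicator B y \<partial>lborel \<partial>?\<nu>)
        = (\<integral>\<^sup>+y. \<integral>\<^sup>+x. ennreal (normal_density (\<theta> \<bullet> x) (sqrt t) y) * indicator B y \<partial>?\<nu> \<partial>lborel)"
        by (rule \<nu>L.Fubini' [symmetric]) measurable
      also have "\<dots> = emeasure (density lborel (cond_density \<theta>)) B"
        by (simp add: nn_integral_multc emeasure_density ennreal_cond_density)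
      finally show "(\<integral>\<^sup>+x. \<integral>\<^sup>+n. ?f (\<theta>, x, n) \<partial>gaussian 0 1 \<partial>?\<nu>)
        = emeasure (density lborel (cond_density \<theta>)) B * indicator A \<theta>"
        by (simp add: mult.commute)
    qed
    finally show ?thesis .
  qed
  \<comment> \<open>A conditional distribution is determined only almost everywhere, which suffices
    under the integral over \<open>\<Theta>\<close>.\<close>
  have P_eq: "AE \<theta> in G. P \<theta> = density lborel (cond_density \<theta>)"
  proof (rule AE_eq_if_AE_eq_atMost)
    show "sigma_finite_measure G" by (rule G.sigma_finite_measure_axioms)
    show "real_distribution (P \<theta>)" for \<theta>
      using measurable_space[OF kernel, of \<theta>]
      by (auto simp: space_prob_algebra real_distribution_def real_distribution_axioms_def)
    show "real_distribution (density lborel (cond_density \<theta>))" for \<theta>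
      using has_bochner_integral_cond_density[of \<theta>] cond_density_pos[of \<theta>]
      by (intro real_distribution.intro prob_spaceI)
        (auto simp: real_distribution_axioms_def emeasure_density nn_integral_eq_integral has_bochner_integral_iff less_imp_le)
    show "(\<lambda>\<theta>. emeasure (P \<theta>) {..a}) \<in> borel_measurable G" for a
      using P_measurable[of "{..a}"] by simp
    show "(\<lambda>\<theta>. emeasure (density lborel (cond_density \<theta>)) {..a}) \<in> borel_measurable G" for a
      by (simp add: emeasure_density)
    show "(\<integral>\<^sup>+\<theta>. emeasure (P \<theta>) {..a} * indicator A \<theta> \<partial>G)
        = (\<integral>\<^sup>+\<theta>. emeasure (density lborel (cond_density \<theta>)) {..a} * indicator A \<theta> \<partial>G)"
      if "A \<in> sets G" for A a
      using cond[of A "{..a}"] joint[of A "{..a}"] that by simp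
  qed
  have "AE \<omega> in M. P (\<Theta> \<omega>) = density lborel (cond_density (\<Theta> \<omega>))"
    using P_eq unfolding law [symmetric] by (rule AE_distrD [rotated]) measurable
  then have "(\<integral>\<^sup>+\<omega>. relative_entropy (P (\<Theta> \<omega>)) (gaussian 0 (\<gamma> + t)) \<partial>M)
      \<le> (\<integral>\<^sup>+\<omega>. \<integral>\<^sup>+y. ennreal (kl_term (cond_density (\<Theta> \<omega>) y) (?q y)) \<partial>lborel \<partial>M)"
  proof (intro nn_integral_mono_AE, eventually_elim)
    case (elim \<omega>)
    have "has_bochner_integral lborel ?q 1"
      using \<open>0 < \<gamma>\<close> t by (auto simp: has_bochner_integral_iff)
    then show ?case
      unfolding elim gaussian_def using \<open>0 < \<gamma>\<close> t
      by (intro relative_entropy_density_le has_bochner_integral_cond_density cond_density_pos normal_density_pos) auto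
  qed
  also have "\<dots> = (\<integral>\<^sup>+\<theta>. \<integral>\<^sup>+y. ennreal (kl_term (cond_density \<theta> y) (?q y)) \<partial>lborel \<partial>G)"
    unfolding law [symmetric] by (rule nn_integral_distr [symmetric]) measurable
  also have "\<dots> \<le> ennreal ((\<integral>x. \<bar>proj_var x - (\<gamma> + t)\<bar> \<partial>?\<nu>) / (2 * t) + sqrt (s * mean_abs_inner / t))"
    using \<open>0 < \<gamma>\<close> by (intro cond_density_kl_le) simp
  also have "(\<integral>x. \<bar>proj_var x - (\<gamma> + t)\<bar> \<partial>?\<nu>) = alpha M X"
  proof -
    have "(\<integral>x. \<bar>proj_var x - (\<gamma> + t)\<bar> \<partial>?\<nu>) = (\<integral>\<omega>. \<bar>proj_var (X \<omega>) - (\<gamma> + t)\<bar> \<partial>M)"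
      by (rule integral_distr) measurable
    also have "\<dots> = (\<integral>\<omega>. s * \<bar>(norm (X \<omega>))\<^sup>2 - (\<integral>\<omega>. (norm (X \<omega>))\<^sup>2 \<partial>M)\<bar> \<partial>M)"
    proof (intro Bochner_Integration.integral_cong refl)
      fix \<omega>
      \<comment> \<open>The noise variance \<open>t\<close> cancels, and \<open>\<gamma>\<close> is
        \<open>s\<close> times the mean of the squared norm.\<close>
      have "proj_var (X \<omega>) - (\<gamma> + t) = s * ((norm (X \<omega>))\<^sup>2 - (\<integral>\<omega>. (norm (X \<omega>))\<^sup>2 \<partial>M))"
        by (simp add: proj_var_def assms(5) [symmetric] s_def [symmetric] right_diff_distrib)
      then show "\<bar>proj_var (X \<omega>) - (\<gamma> + t)\<bar> = s * \<bar>(norm (X \<omega>))\<^sup>2 - (\<integral>\<omega>. (norm (X \<omega>))\<^sup>2 \<partial>M)\<bar>"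
        using s by (simp add: abs_mult)
    qed
    finally show ?thesis by (simp add: alpha_def s_def)
  qed
  also have "s * mean_abs_inner = beta1 M X"
    by (simp add: beta1_def mean_abs_inner_def s_def)
  finally show ?thesis .
qed

end
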